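(* Let $V$ be a Banach space with enveloping semigroup $\mathcal{E}(V)$. The following conditions are equivalent (condition (2) being included only when $V$ is infinite-dimensional): (1) $V$ is a separable Asplund space. (2) (for infinite-dimensional $V$) $\mathcal{E}(V)$ is homeomorphic to the Hilbert cube $[-1,1]^{\mathbb{N}}$. (3) $\mathcal{E}(V)$ is metrizable.
   Context: Banach spaces are real. $\Theta(V)$ is the semigroup of all linear operators $T:V\to V$ with $\|T\|\le 1$. $B^*$ is the closed unit ball of $V^*$ with the weak$^*$ topology. The opposite semigroup $\Theta(V)^{op}$ is identified with the semigroup of adjoint operators $\{T^*: T\in\Theta(V)\}$, which acts from the left on $B^*$. The enveloping semigroup $\mathcal{E}(V)$ of $V$ is the closure of $\{T^*|_{B^*}: T\in\Theta(V)\}$ in $(B^* )^{B^*}$ with the product (pointwise weak$^*$) topology; its operation is composition of maps. A Banach space is Asplund if the dual of each of its separable Banach subspaces is separable. *)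

theory Defs
  imports "HOL-Analysis.Analysis"
begin

section \<open>Asplund spaces\<close>

text \<open>A closed linear subspace \<open>W\<close> of a Banach space is a set rather than a type, so its dual
  is a set of functions, made extensional (equal to \<open>undefined\<close> off \<open>W\<close>) in order that a functional
  on \<open>W\<close> be represented by exactly one function.\<close>

definition subspace_dual :: "'a::real_normed_vector set \<Rightarrow> ('a \<Rightarrow> real) set" where
  "subspace_dual W =
     {f \<in> extensional W.
        (\<forall>x\<in>W. \<forall>y\<in>W. f (x + y) = f x + f y) \<and>
        (\<forall>c. \<forall>x\<in>W. f (c *\<^sub>R x) = c * f x) \<and>
        (\<exists>K. \<forall>x\<in>W. \<bar>f x\<bar> \<le> K * norm x)}"

text \<open>The distance of the dual norm. The value \<open>0\<close> off the dual is only there because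
  \<^locale>\<open>Metric_space\<close> asks for nonnegativity at all arguments.\<close>

definition subspace_dual_dist :: "'a::real_normed_vector set \<Rightarrow> ('a \<Rightarrow> real) \<Rightarrow> ('a \<Rightarrow> real) \<Rightarrow> real" where
  "subspace_dual_dist W f g =
     (if f \<in> subspace_dual W \<and> g \<in> subspace_dual W
      then (SUP x\<in>{x \<in> W. norm x \<le> 1}. \<bar>f x - g x\<bar>) else 0)"

definition subspace_dual_topology :: "'a::real_normed_vector set \<Rightarrow> ('a \<Rightarrow> real) topology" where
  "subspace_dual_topology W = Metric_space.mtopology (subspace_dual W) (subspace_dual_dist W)"

definition asplund :: "'a::banach itself \<Rightarrow> bool" where
  "asplund _ \<longleftrightarrow>
     (\<forall>W :: 'a set. subspace W \<and> closed W \<and> separable_space (top_of_set W)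
        \<longrightarrow> separable_space (subspace_dual_topology W))"

definition infinite_dimensional :: "'a::real_vector itself \<Rightarrow> bool" where
  "infinite_dimensional _ \<longleftrightarrow> \<not> (\<exists>B :: 'a set. finite B \<and> span B = UNIV)"

lemma subspace_dual_dist_bound:
  assumes "f \<in> subspace_dual W" "g \<in> subspace_dual W"
  shows "bdd_above ((\<lambda>x. \<bar>f x - g x\<bar>) ` {x \<in> W. norm x \<le> 1})"
proof -
  obtain K L where K: "\<And>x. x \<in> W \<Longrightarrow> \<bar>f x\<bar> \<le> K * norm x"
    and L: "\<And>x. x \<in> W \<Longrightarrow> \<bar>g x\<bar> \<le> L * norm x"
    using assms unfolding subspace_dual_def by blast
  have "\<bar>f x - g x\<bar> \<le> \<bar>K\<bar> + \<bar>L\<bar>" if "x \<in> W" "norm x \<le> 1" for x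
  proof -
    have "K * norm x \<le> \<bar>K\<bar> * 1" "L * norm x \<le> \<bar>L\<bar> * 1"
      using mult_mono[of K "\<bar>K\<bar>" "norm x" 1] mult_mono[of L "\<bar>L\<bar>" "norm x" 1] that by auto
    then show ?thesis using K[of x] L[of x] that by linarith
  qed
  then show ?thesis by (intro bdd_aboveI2) auto
qed

lemma Metric_space_subspace_dual:
  assumes "subspace W"
  shows "Metric_space (subspace_dual W) (subspace_dual_dist W)"
proof
  fix f g h
  let ?B = "{x \<in> W. norm x \<le> 1}"
  have 0: "0 \<in> ?B" using subspace_0[OF assms] by simp
  have upper: "\<bar>f x - g x\<bar> \<le> subspace_dual_dist W f g"
    if "f \<in> subspace_dual W" "g \<in> subspace_dual W" "x \<in> ?B" for f g x
    using cSUP_upper[OF that(3) subspace_dual_dist_bound[OF that(1,2)]] that(1,2)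
    by (simp add: subspace_dual_dist_def)
  show "0 \<le> subspace_dual_dist W f g"
  proof (cases "f \<in> subspace_dual W \<and> g \<in> subspace_dual W")
    case True
    then have "\<bar>f 0 - g 0\<bar> \<le> subspace_dual_dist W f g" using upper 0 by blast
    then show ?thesis by linarith
  next
    case False
    then show ?thesis unfolding subspace_dual_dist_def by (simp only: if_False)
  qed
  show "subspace_dual_dist W f g = subspace_dual_dist W g f"
    by (auto simp: subspace_dual_dist_def abs_minus_commute)
  assume fg: "f \<in> subspace_dual W" "g \<in> subspace_dual W"
  show "subspace_dual_dist W f g = 0 \<longleftrightarrow> f = g"
  proof
    assume eq: "subspace_dual_dist W f g = 0"
    show "f = g"
    proof
      fix x
      show "f x = g x"
      proof (cases "x \<in> W \<and> x \<noteq> 0")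
        case True
        define c where "c = inverse (norm x)"
        have c: "c \<noteq> 0" "c *\<^sub>R x \<in> ?B"
          using True subspace_scale[OF assms, of x] by (auto simp: c_def)
        have "\<bar>f (c *\<^sub>R x) - g (c *\<^sub>R x)\<bar> \<le> 0"
          using upper[OF fg c(2)] eq by linarith
        moreover have "f (c *\<^sub>R x) = c * f x" "g (c *\<^sub>R x) = c * g x"
          using fg True unfolding subspace_dual_def by auto
        ultimately show ?thesis using c(1) by simp
      next
        case False
        show ?thesis
        proof (cases "x \<in> W")
          case True
          then have "x = 0" using False by simp
          moreover have "\<bar>f 0 - g 0\<bar> \<le> 0" using upper[OF fg 0] eq by linarith
          ultimately show ?thesis by simp
        next
          case False
          then show ?thesis using fg by (auto simp: subspace_dual_def extensional_def)
        qed
      qed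
    qed
  next
    assume "f = g"
    moreover have "(SUP x\<in>?B. 0::real) = 0" using 0 by (intro cSUP_const) blast
    ultimately show "subspace_dual_dist W f g = 0" by (simp add: subspace_dual_dist_def)
  qed
  assume h: "h \<in> subspace_dual W"
  have "(SUP x\<in>?B. \<bar>f x - h x\<bar>) \<le> subspace_dual_dist W f g + subspace_dual_dist W g h"
  proof (rule cSUP_least)
    show "?B \<noteq> {}" using 0 by blast
    fix x assume "x \<in> ?B"
    then show "\<bar>f x - h x\<bar> \<le> subspace_dual_dist W f g + subspace_dual_dist W g h"
      using upper[OF fg, of x] upper[OF fg(2) h, of x] by linarith
  qed
  then show "subspace_dual_dist W f h \<le> subspace_dual_dist W f g + subspace_dual_dist W g h"
    using fg h by (simp add: subspace_dual_dist_def)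
qed

section \<open>The enveloping semigroup\<close>

definition contractions :: "('a::real_normed_vector \<Rightarrow>\<^sub>L 'a) set" where
  "contractions = {T. norm T \<le> 1}"

definition dual_ball :: "('a::real_normed_vector \<Rightarrow>\<^sub>L real) set" where
  "dual_ball = cball 0 1"

text \<open>For operators with values in the reals, the strong operator topology is the topology of
  pointwise convergence on the dual, that is, the weak-star topology.\<close>

definition dual_ball_topology :: "('a::real_normed_vector \<Rightarrow>\<^sub>L real) topology" where
  "dual_ball_topology = subtopology strong_operator_topology dual_ball"

definition adjoint_op :: "('a::real_normed_vector \<Rightarrow>\<^sub>L 'a) \<Rightarrow> ('a \<Rightarrow>\<^sub>L real) \<Rightarrow> ('a \<Rightarrow>\<^sub>L real)" where
  "adjoint_op T \<phi> = \<phi> o\<^sub>L T"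

text \<open>Self-maps of the dual ball are represented by functions extensional on it.\<close>

definition dual_ball_maps_topology ::
  "(('a::real_normed_vector \<Rightarrow>\<^sub>L real) \<Rightarrow> ('a \<Rightarrow>\<^sub>L real)) topology" where
  "dual_ball_maps_topology = product_topology (\<lambda>_. dual_ball_topology) dual_ball"

definition enveloping_semigroup ::
  "(('a::real_normed_vector \<Rightarrow>\<^sub>L real) \<Rightarrow> ('a \<Rightarrow>\<^sub>L real)) set" where
  "enveloping_semigroup =
     dual_ball_maps_topology closure_of ((\<lambda>T. restrict (adjoint_op T) dual_ball) ` contractions)"

definition enveloping_topology ::
  "'a::real_normed_vector itself \<Rightarrow> (('a \<Rightarrow>\<^sub>L real) \<Rightarrow> ('a \<Rightarrow>\<^sub>L real)) topology" where
  "enveloping_topology _ = subtopology dual_ball_maps_topology enveloping_semigroup"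

lemma restrict_adjoint_op_in_topspace:
  assumes "T \<in> contractions"
  shows "restrict (adjoint_op T) dual_ball \<in> topspace dual_ball_maps_topology"
proof -
  have "norm (\<phi> o\<^sub>L T) \<le> 1" if "norm \<phi> \<le> 1" for \<phi> :: "'a \<Rightarrow>\<^sub>L real"
  proof -
    have "norm (\<phi> o\<^sub>L T) \<le> norm \<phi> * norm T" by (rule norm_blinfun_compose)
    also have "\<dots> \<le> 1" using that assms by (intro mult_le_one) (auto simp: contractions_def)
    finally show ?thesis .
  qed
  then show ?thesis
    by (auto simp: dual_ball_maps_topology_def dual_ball_topology_def dual_ball_def
        adjoint_op_def strong_operator_topology_topspace)
qed

definition hilbert_cube :: "(nat \<Rightarrow> real) topology" where
  "hilbert_cube = product_topology (\<lambda>_. top_of_set {-1..1}) UNIV"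

end

theory Submission
  imports Defs
begin

text \<open>All three conditions are compared with the norm-separability of \<open>V\<^sup>*\<close>. A separable Asplund space has
a separable dual because it is one of its own separable subspaces; conversely a separable dual makes
\<open>V\<close> separable and, since functionals extend from subspaces by the Hahn-Banach theorem, makes \<open>V\<close>
Asplund.

Suppose \<open>V\<^sup>*\<close> and \<open>V\<close> are separable. The elements of \<open>\<E>(V)\<close> are nonexpansive maps of the dual ball, so
such a \<open>p\<close> is determined by the countably many numbers \<open>p(a\<^sub>n)(b\<^sub>n)\<close>, where \<open>(a\<^sub>n, b\<^sub>n)\<close> runs through
pairs taken from dense sequences of the dual ball and of \<open>V\<close>. By the theorems of Banach-Alaoglu and
Tychonoff \<open>\<E>(V)\<close> is compact, so these coordinates embed it into the space of real sequences
(\<open>enveloping_coordinates\<close>, \<open>enveloping_homeomorphic_image\<close>), and it is metrizable.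

Conversely suppose \<open>\<E>(V)\<close> is metrizable. Only a countable neighbourhood base at \<open>0\<close> matters. Each
member of it contains all \<open>p\<close> that vanish at certain finitely many functionals; let \<open>D\<close> be the countable
set of all functionals so obtained. If a functional \<open>\<psi>\<close> had positive distance from the span of \<open>D\<close>, then by
Hahn-Banach the unit ball would contain, for every member of the base, a vector \<open>v\<close> annihilated by its
finitely many functionals with \<open>\<psi>(v)\<close> bounded away from \<open>0\<close>. The adjoints \<open>\<phi> \<mapsto> \<phi>(v) f\<close> of rank one
operators, with \<open>f\<close> fixed, would then come into every neighbourhood of \<open>0\<close> without becoming small
at \<open>\<psi>\<close>. So the span of \<open>D\<close> is dense (\<open>dual_separable_if_first_countable\<close>).

For the Hilbert cube, the coordinates turn \<open>\<E>(V)\<close> into a compact convex symmetric set of sequences, and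
if \<open>V\<close> is infinite-dimensional this set contains nonzero points at which any given finitely many
coordinates vanish. It remains to prove the symmetric case of a theorem of Keller
(\<open>keller_symmetric\<close>): such a set \<open>K\<close> is a Hilbert cube. The projection of \<open>K\<close> to the first \<open>n\<close> coordinates
is, after coordinates that carry no information are discarded, the unit ball of a norm \<open>N\<^sub>n\<close> on
\<open>\<real>\<^sup>n\<close>. Positively homogeneous homeomorphisms \<open>\<theta>\<^sub>n\<close> of \<open>\<real>\<^sup>n\<close> that carry \<open>N\<^sub>n\<close> to the maximum norm are
built one after another, in such a way that on \<open>K\<close> the first \<open>n\<close> components of \<open>\<theta>\<^sub>n\<^sub>+\<^sub>1\<close> differ from \<open>\<theta>\<^sub>n\<close> by
at most a prescribed \<open>\<epsilon>\<^sub>n\<close> (\<open>cube_chart_step\<close>). With \<open>\<epsilon>\<^sub>n\<close> small compared with the moduli of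
injectivity of \<open>\<theta>\<^sub>0, \<dots>, \<theta>\<^sub>n\<close>, the limit of the \<open>\<theta>\<^sub>n\<close> is a homeomorphism of \<open>K\<close> onto the cube.

In the step, the new component has to be increasing in the last coordinate \<open>s\<close> and to stretch almost
every fibre of the projection from \<open>N\<^sub>n\<^sub>+\<^sub>1 \<le> 1\<close> to \<open>N\<^sub>n \<le> 1\<close> to nearly all of \<open>[-1, 1]\<close>, although the
endpoints of the fibres need not depend continuously on the base point. The convex function
\<open>s \<mapsto> N\<^sub>n\<^sub>+\<^sub>1(x, s)\<close>, whose minimum is \<open>N\<^sub>n(x)\<close>, is the maximum of a nondecreasing function \<open>A\<close> and a
nonincreasing function \<open>B\<close>, both continuous in \<open>(x, s)\<close>, with minimum \<open>N\<^sub>n(x)\<close>. A large multiple of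
\<open>A - B\<close>, truncated to \<open>[-B, A]\<close>, is monotone in \<open>s\<close> and has absolute value \<open>N\<^sub>n\<^sub>+\<^sub>1\<close> unless \<open>N\<^sub>n\<^sub>+\<^sub>1\<close> is already
close to \<open>N\<^sub>n\<close>.\<close>

section \<open>Gauges of the projections of a symmetric compact convex set of sequences\<close>

definition agree :: "nat \<Rightarrow> (nat \<Rightarrow> real) \<Rightarrow> (nat \<Rightarrow> real) \<Rightarrow> bool" where
  "agree n x y \<longleftrightarrow> (\<forall>i<n. x i = y i)"

definition below :: "nat \<Rightarrow> (nat \<Rightarrow> real) \<Rightarrow> (nat \<Rightarrow> real) \<Rightarrow> bool" where
  "below n x y \<longleftrightarrow> agree n x y \<and> x n \<le> y n"

text \<open>Such a relation is membership of \<open>x - y\<close> in a convex cone that contains all sequences vanishing on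
the coordinates \<open>0, \<dots>, n\<close>.\<close>

definition conic_rel :: "nat \<Rightarrow> ((nat \<Rightarrow> real) \<Rightarrow> (nat \<Rightarrow> real) \<Rightarrow> bool) \<Rightarrow> bool" where
  "conic_rel n R \<longleftrightarrow>
     (\<forall>x y. agree (Suc n) x y \<longrightarrow> R x y) \<and>
     (\<forall>x y x' y'. R x y \<longrightarrow> R x' y' \<longrightarrow> R (\<lambda>i. x i + x' i) (\<lambda>i. y i + y' i)) \<and>
     (\<forall>c x y. 0 < c \<longrightarrow> R x y \<longrightarrow> R (\<lambda>i. c * x i) (\<lambda>i. c * y i))"

lemma agree_sym: "agree n x y \<Longrightarrow> agree n y x"
  and agree_trans: "agree n x y \<Longrightarrow> agree n y z \<Longrightarrow> agree n x z"
  by (auto simp: agree_def)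

lemma agree_Suc: "agree (Suc n) x y \<longleftrightarrow> agree n x y \<and> x n = y n"
  by (auto simp: agree_def less_Suc_eq)

lemma conic_agree_Suc: "conic_rel n (agree (Suc n))"
  by (auto simp: conic_rel_def agree_def)

lemma conic_agree: "conic_rel n (agree n)"
  by (auto simp: conic_rel_def agree_def)

lemma conic_below: "conic_rel n (below n)"
  by (auto simp: conic_rel_def below_def agree_def add_mono)

lemma tendsto_coordinatewise:
  fixes f :: "'b \<Rightarrow> 'i \<Rightarrow> 'c::topological_space"
  assumes "\<And>i. ((\<lambda>n. f n i) \<longlongrightarrow> l i) F"
  shows "(f \<longlongrightarrow> l) F"
proof -
  have "limitin (product_topology (\<lambda>_. euclidean) UNIV) f l F"
    unfolding limitin_componentwise using assms by simp
  then show ?thesis by (simp add: euclidean_product_topology)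
qed

text \<open>The last condition says that the projections of \<open>K\<close> absorb every vector, so that each of them is a
neighbourhood of \<open>0\<close> in \<open>\<real>\<^sup>n\<close>.\<close>

locale symmetric_body =
  fixes K :: "(nat \<Rightarrow> real) set"
  assumes compact: "compact K"
    and convex: "\<lbrakk>x \<in> K; y \<in> K; 0 \<le> u; u \<le> 1\<rbrakk> \<Longrightarrow> (\<lambda>i. u * x i + (1 - u) * y i) \<in> K"
    and symmetric: "x \<in> K \<Longrightarrow> (\<lambda>i. - x i) \<in> K"
    and absorbing: "\<exists>t>0. \<exists>k\<in>K. agree n x (\<lambda>i. t * k i)"
begin

lemma nonempty: "K \<noteq> {}"
  using absorbing[of 0 undefined] by auto

lemma zero_mem: "(\<lambda>_. 0) \<in> K"
proof -
  obtain k where "k \<in> K" using nonempty by blast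
  then show ?thesis using convex[of k "\<lambda>i. - k i" "1/2"] symmetric by simp
qed

lemma scale_mem: "(\<lambda>i. c * k i) \<in> K" if "k \<in> K" "\<bar>c\<bar> \<le> 1"
proof (cases "c \<ge> 0")
  case True
  then show ?thesis using convex[OF that(1) zero_mem, of c] that by simp
next
  case False
  then show ?thesis using convex[OF symmetric[OF that(1)] zero_mem, of "-c"] that by simp
qed

lemma combine_mem:
  assumes "k \<in> K" "l \<in> K" "0 < s" "0 < t"
  shows "\<exists>m\<in>K. \<forall>i. s * k i + t * l i = (s + t) * m i"
proof
  show "(\<lambda>i. s / (s + t) * k i + (1 - s / (s + t)) * l i) \<in> K"
    using assms by (intro convex) auto
  have "(s + t) * (s / (s + t)) = s" "(s + t) * (1 - s / (s + t)) = t"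
    using assms by (auto simp: field_simps)
  then show "\<forall>i. s * k i + t * l i = (s + t) * (s / (s + t) * k i + (1 - s / (s + t)) * l i)"
    by (metis (no_types, lifting) mult.assoc distrib_left)
qed

definition gauge_set :: "((nat \<Rightarrow> real) \<Rightarrow> (nat \<Rightarrow> real) \<Rightarrow> bool) \<Rightarrow> (nat \<Rightarrow> real) \<Rightarrow> real set" where
  "gauge_set R x = {t. 0 < t \<and> (\<exists>k\<in>K. R x (\<lambda>i. t * k i))}"

text \<open>The Minkowski functional of the sum of \<open>K\<close> and the cone of \<open>R\<close>. Equality of the first \<open>n\<close> coordinates
gives the gauge of a projection of \<open>K\<close>, and \<^const>\<open>below\<close> gives the gauge of
the part of space that lies below a projection of \<open>K\<close>.\<close>

definition cone_gauge :: "((nat \<Rightarrow> real) \<Rightarrow> (nat \<Rightarrow> real) \<Rightarrow> bool) \<Rightarrow> (nat \<Rightarrow> real) \<Rightarrow> real" where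
  "cone_gauge R x = Inf (gauge_set R x)"

lemma gauge_set_bdd: "bdd_below (gauge_set R x)"
  by (rule bdd_belowI[of _ 0]) (auto simp: gauge_set_def)

lemma gauge_set_nonempty: "conic_rel n R \<Longrightarrow> gauge_set R x \<noteq> {}"
  using absorbing[of "Suc n" x] by (fastforce simp: gauge_set_def conic_rel_def)

lemma cone_gauge_nonneg: "conic_rel n R \<Longrightarrow> 0 \<le> cone_gauge R x"
  unfolding cone_gauge_def by (rule cInf_greatest[OF gauge_set_nonempty]) (auto simp: gauge_set_def)

lemma cone_gauge_leI: "\<lbrakk>0 < t; k \<in> K; R x (\<lambda>i. t * k i)\<rbrakk> \<Longrightarrow> cone_gauge R x \<le> t"
  unfolding cone_gauge_def by (rule cInf_lower[OF _ gauge_set_bdd]) (auto simp: gauge_set_def)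

lemma cone_gauge_lessD:
  assumes "conic_rel n R" "cone_gauge R x < t"
  shows "\<exists>k\<in>K. R x (\<lambda>i. t * k i)"
proof -
  obtain s k where s: "0 < s" "s < t" "k \<in> K" "R x (\<lambda>i. s * k i)"
    using cInf_lessD[OF gauge_set_nonempty[OF assms(1)], of x t] assms(2)
    by (auto simp: cone_gauge_def gauge_set_def)
  have "(\<lambda>i. s / t * k i) \<in> K" using s by (intro scale_mem) auto
  moreover have "(\<lambda>i. s * k i) = (\<lambda>i. t * (s / t * k i))" using s by auto
  ultimately show ?thesis using s(4) by metis
qed

lemma cone_gauge_lessD_pos:
  assumes "conic_rel n R" "cone_gauge R x < t"
  shows "0 < t"
  using cone_gauge_nonneg[OF assms(1), of x] assms(2) by linarith

lemma cone_gauge_scale_le: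
  assumes "conic_rel n R" "0 < c"
  shows "cone_gauge R (\<lambda>i. c * x i) \<le> c * cone_gauge R x"
proof (rule field_le_epsilon)
  fix e :: real assume e: "0 < e"
  define t where "t = cone_gauge R x + e / c"
  have t: "cone_gauge R x < t" using e assms(2) by (simp add: t_def)
  obtain k where k: "k \<in> K" "R x (\<lambda>i. t * k i)" using cone_gauge_lessD[OF assms(1) t] by blast
  have "R (\<lambda>i. c * x i) (\<lambda>i. c * (t * k i))" using assms k(2) unfolding conic_rel_def by blast
  then have "cone_gauge R (\<lambda>i. c * x i) \<le> c * t"
    using cone_gauge_lessD_pos[OF assms(1) t] assms(2) k(1) by (intro cone_gauge_leI) (auto simp: mult.assoc)
  also have "c * t = c * cone_gauge R x + e" using assms(2) by (simp add: t_def field_simps)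
  finally show "cone_gauge R (\<lambda>i. c * x i) \<le> c * cone_gauge R x + e" .
qed

lemma cone_gauge_scale:
  assumes "conic_rel n R" "0 < c"
  shows "cone_gauge R (\<lambda>i. c * x i) = c * cone_gauge R x"
proof (rule antisym[OF cone_gauge_scale_le[OF assms]])
  have "cone_gauge R (\<lambda>i. inverse c * (c * x i)) \<le> inverse c * cone_gauge R (\<lambda>i. c * x i)"
    using assms by (intro cone_gauge_scale_le) auto
  also have "(\<lambda>i. inverse c * (c * x i)) = x" using assms(2) by auto
  finally show "c * cone_gauge R x \<le> cone_gauge R (\<lambda>i. c * x i)"
    using assms(2) by (simp add: field_simps)
qed

lemma cone_gauge_add:
  assumes "conic_rel n R"
  shows "cone_gauge R (\<lambda>i. x i + y i) \<le> cone_gauge R x + cone_gauge R y"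
proof (rule field_le_epsilon)
  fix e :: real assume e: "0 < e"
  define s t where "s = cone_gauge R x + e / 2" and "t = cone_gauge R y + e / 2"
  have s: "cone_gauge R x < s" and t: "cone_gauge R y < t" using e by (auto simp: s_def t_def)
  obtain k l where kl: "k \<in> K" "R x (\<lambda>i. s * k i)" "l \<in> K" "R y (\<lambda>i. t * l i)"
    using cone_gauge_lessD[OF assms s] cone_gauge_lessD[OF assms t] by blast
  have pos: "0 < s" "0 < t" using cone_gauge_lessD_pos[OF assms] s t by auto
  obtain m where m: "m \<in> K" "\<And>i. s * k i + t * l i = (s + t) * m i"
    using combine_mem[OF kl(1,3) pos] by blast
  have "R (\<lambda>i. x i + y i) (\<lambda>i. s * k i + t * l i)" using assms kl(2,4) unfolding conic_rel_def by blast
  then have "cone_gauge R (\<lambda>i. x i + y i) \<le> s + t"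
    using pos m by (intro cone_gauge_leI[of _ m]) auto
  then show "cone_gauge R (\<lambda>i. x i + y i) \<le> cone_gauge R x + cone_gauge R y + e" by (simp add: s_def t_def)
qed

lemma cone_gauge_zero:
  assumes "conic_rel n R"
  shows "cone_gauge R (\<lambda>_. 0) = 0"
  using cone_gauge_scale[OF assms, of 2 "\<lambda>_. 0"] by simp

lemma cone_gauge_mono:
  assumes "conic_rel n R" "\<And>x y. R x y \<Longrightarrow> S x y"
  shows "cone_gauge S x \<le> cone_gauge R x"
  unfolding cone_gauge_def using assms
  by (intro cInf_superset_mono[OF gauge_set_nonempty[OF assms(1)] gauge_set_bdd])
     (auto simp: gauge_set_def)

abbreviation proj_norm :: "nat \<Rightarrow> (nat \<Rightarrow> real) \<Rightarrow> real" where
  "proj_norm n \<equiv> cone_gauge (agree n)"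

lemma proj_norm_uminus: "proj_norm n (\<lambda>i. - x i) = proj_norm n x"
proof -
  have *: "proj_norm n (\<lambda>i. - x i) \<le> proj_norm n x" for x
    unfolding cone_gauge_def
  proof (rule cInf_superset_mono[OF gauge_set_nonempty[OF conic_agree] gauge_set_bdd], rule)
    fix t assume "t \<in> gauge_set (agree n) x"
    then obtain k where "0 < t" "k \<in> K" "agree n x (\<lambda>i. t * k i)" by (auto simp: gauge_set_def)
    then show "t \<in> gauge_set (agree n) (\<lambda>i. - x i)"
      using symmetric[of k] by (auto simp: gauge_set_def agree_def intro!: bexI[of _ "\<lambda>i. - k i"])
  qed
  show ?thesis using *[of x] *[of "\<lambda>i. - x i"] by simp
qed

lemma proj_norm_scale: "proj_norm n (\<lambda>i. c * x i) = \<bar>c\<bar> * proj_norm n x"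
proof -
  consider "c = 0" | "c > 0" | "c < 0" by linarith
  then show ?thesis
  proof cases
    case 1 then show ?thesis using cone_gauge_zero[OF conic_agree] by simp
  next
    case 2 then show ?thesis using cone_gauge_scale[OF conic_agree] by simp
  next
    case 3
    have "proj_norm n (\<lambda>i. - (c * x i)) = (-c) * proj_norm n x"
      using cone_gauge_scale[OF conic_agree, of "-c" n x] 3 by simp
    then show ?thesis using 3 proj_norm_uminus[of n "\<lambda>i. c * x i"] by simp
  qed
qed

lemma proj_norm_cong: "agree n x y \<Longrightarrow> proj_norm n x = proj_norm n y"
  by (simp add: cone_gauge_def gauge_set_def agree_def)

definition unit :: "nat \<Rightarrow> nat \<Rightarrow> real" where
  "unit j = (\<lambda>i. if i = j then 1 else 0)"

lemma proj_norm_le_sum: "proj_norm n x \<le> (\<Sum>j<n. \<bar>x j\<bar> * proj_norm n (unit j))"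
proof -
  have "proj_norm n (\<lambda>i. if i < m then x i else 0) \<le> (\<Sum>j<m. \<bar>x j\<bar> * proj_norm n (unit j))" for m
  proof (induction m)
    case 0
    then show ?case using cone_gauge_zero[OF conic_agree] by simp
  next
    case (Suc m)
    have eq: "(\<lambda>i. if i < Suc m then x i else 0)
        = (\<lambda>i. (if i < m then x i else 0) + x m * unit m i)"
      by (rule ext) (auto simp: unit_def less_Suc_eq)
    have "proj_norm n (\<lambda>i. if i < Suc m then x i else 0)
        \<le> proj_norm n (\<lambda>i. if i < m then x i else 0) + proj_norm n (\<lambda>i. x m * unit m i)"
      unfolding eq by (rule cone_gauge_add[OF conic_agree])
    then show ?case using Suc by (simp add: proj_norm_scale)
  qed
  from this[of n] show ?thesis
    using proj_norm_cong[of n x "\<lambda>i. if i < n then x i else 0"] by (simp add: agree_def)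
qed

text \<open>By subadditivity a gauge changes by at most the gauge of the difference, and this is at most the
norm of its first \<open>n + 1\<close> coordinates. Hence gauges are Lipschitz.\<close>

lemma cone_gauge_diff_le:
  assumes "conic_rel n R"
  shows "\<bar>cone_gauge R y - cone_gauge R x\<bar> \<le> (\<Sum>j<Suc n. \<bar>y j - x j\<bar> * proj_norm (Suc n) (unit j))"
proof -
  have "cone_gauge R u - cone_gauge R v \<le> (\<Sum>j<Suc n. \<bar>u j - v j\<bar> * proj_norm (Suc n) (unit j))" for u v
  proof -
    have "cone_gauge R u \<le> cone_gauge R v + cone_gauge R (\<lambda>i. u i - v i)"
      using cone_gauge_add[OF assms, of v "\<lambda>i. u i - v i"] by simp
    also have "cone_gauge R (\<lambda>i. u i - v i) \<le> proj_norm (Suc n) (\<lambda>i. u i - v i)"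
      using assms by (intro cone_gauge_mono[OF conic_agree_Suc]) (auto simp: conic_rel_def)
    also have "\<dots> \<le> (\<Sum>j<Suc n. \<bar>u j - v j\<bar> * proj_norm (Suc n) (unit j))" by (rule proj_norm_le_sum)
    finally show ?thesis by simp
  qed
  from this[of y x] this[of x y] show ?thesis by (simp add: abs_minus_commute abs_le_iff)
qed

lemma continuous_cone_gauge:
  assumes "conic_rel n R"
  shows "continuous_on UNIV (cone_gauge R)"
  unfolding continuous_on_eq_continuous_at[OF open_UNIV]
proof
  fix x
  have "((\<lambda>y. (\<Sum>j<Suc n. \<bar>y j - x j\<bar> * proj_norm (Suc n) (unit j)))
          \<longlongrightarrow> (\<Sum>j<Suc n. \<bar>x j - x j\<bar> * proj_norm (Suc n) (unit j))) (at x)"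
  proof (intro tendsto_intros)
    fix j
    show "((\<lambda>y. y j) \<longlongrightarrow> x j) (at x)"
      using continuous_on_product_coordinates[of j]
      by (metis UNIV_I continuous_on_def)
  qed
  then have "((\<lambda>y. (\<Sum>j<Suc n. \<bar>y j - x j\<bar> * proj_norm (Suc n) (unit j))) \<longlongrightarrow> 0) (at x)" by simp
  then have "((\<lambda>y. cone_gauge R y - cone_gauge R x) \<longlongrightarrow> 0) (at x)"
    by (rule Lim_null_comparison[rotated]) (use cone_gauge_diff_le[OF assms] in auto)
  then show "isCont (cone_gauge R) x" unfolding isCont_def using LIM_zero_iff by blast
qed

end

section \<open>Monotone parts of the gauge along a fibre\<close>

text \<open>The difference \<open>a - b\<close>, steepened by a small \<open>\<eta>\<close> and truncated to \<open>[-b, a]\<close>. The truncation bounds move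
in the same direction as the difference, so monotonicity survives.\<close>

definition clip :: "real \<Rightarrow> real \<Rightarrow> real \<Rightarrow> real" where
  "clip \<eta> a b = min a (max (- b) ((a - b) / \<eta>))"

lemma clip_mono:
  assumes "0 < \<eta>" "a \<le> a'" "b' \<le> b"
  shows "clip \<eta> a b \<le> clip \<eta> a' b'"
proof -
  have "(a - b) / \<eta> \<le> (a' - b') / \<eta>" using assms by (intro divide_right_mono) auto
  then show ?thesis using assms by (auto simp: clip_def min_def max_def)
qed

lemma clip_scale:
  assumes "0 < c"
  shows "clip \<eta> (c * a) (c * b) = c * clip \<eta> a b"
proof -
  have "c * a - c * b = c * (a - b)" by (simp add: algebra_simps)
  then show ?thesis using assms
    by (simp add: clip_def min_mult_distrib_left max_mult_distrib_left)
qed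

text \<open>If \<open>b \<le> a\<close>, the value is \<open>a\<close> or \<open>(a - b) / \<eta>\<close>; the second case occurs only for \<open>a - b < \<eta> a\<close>, when \<open>b\<close>
itself is close to \<open>a\<close>.\<close>

lemma clip_bounds:
  assumes "0 \<le> a" "0 \<le> b" "0 < \<eta>" "\<eta> < 1"
  shows "\<bar>clip \<eta> a b\<bar> \<le> max a b"
    and "(1 - \<eta>) * max a b \<le> max (min a b) \<bar>clip \<eta> a b\<bar>"
proof -
  have *: "\<bar>clip \<eta> a b\<bar> \<le> a \<and> (1 - \<eta>) * a \<le> max b \<bar>clip \<eta> a b\<bar>" if "b \<le> a" "0 \<le> b" for a b
  proof -
    have "0 \<le> (a - b) / \<eta>" using that assms by simp
    then have c: "clip \<eta> a b = min a ((a - b) / \<eta>)" using that by (simp add: clip_def)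
    then have c0: "0 \<le> clip \<eta> a b" "clip \<eta> a b \<le> a" using \<open>0 \<le> (a - b) / \<eta>\<close> that by auto
    show ?thesis
    proof (cases "a \<le> (a - b) / \<eta>")
      case True
      then have "clip \<eta> a b = a" using c by simp
      moreover have "(1 - \<eta>) * a \<le> 1 * a" using that assms by (intro mult_right_mono) auto
      ultimately show ?thesis using c0 by auto
    next
      case False
      then have "a - b < \<eta> * a" using assms by (simp add: field_simps)
      then have "(1 - \<eta>) * a \<le> b" by (simp add: algebra_simps)
      then show ?thesis using c0 by auto
    qed
  qed
  have sym: "clip \<eta> b a = - clip \<eta> a b" if "0 \<le> a" "0 \<le> b" for a b
  proof -
    have "(b - a) / \<eta> = - ((a - b) / \<eta>)" by (simp add: diff_divide_distrib)
    then show ?thesis using that by (auto simp: clip_def min_def max_def)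
  qed
  show "\<bar>clip \<eta> a b\<bar> \<le> max a b"
    using *[of b a] *[of a b] sym[OF assms(1,2)] assms by (cases "b \<le> a") (auto simp: max_def)
  show "(1 - \<eta>) * max a b \<le> max (min a b) \<bar>clip \<eta> a b\<bar>"
  proof (cases "b \<le> a")
    case True
    then show ?thesis using *[of b a] assms by (simp add: max_absorb1 min_absorb2)
  next
    case False
    then show ?thesis using *[of a b] sym[OF assms(1,2)] assms by (simp add: max_absorb2 min_absorb1)
  qed
qed

context symmetric_body begin

text \<open>As functions of the coordinate \<open>n\<close> with the earlier ones fixed, these are the nondecreasing and the
nonincreasing part of the norm of the projection to \<open>n + 1\<close> coordinates.\<close>

definition upper :: "nat \<Rightarrow> (nat \<Rightarrow> real) \<Rightarrow> real" where
  "upper n = cone_gauge (below n)"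

definition lower :: "nat \<Rightarrow> (nat \<Rightarrow> real) \<Rightarrow> real" where
  "lower n x = upper n (\<lambda>i. - x i)"

lemma upper_nonneg: "0 \<le> upper n x" and lower_nonneg: "0 \<le> lower n x"
  by (simp_all add: upper_def lower_def cone_gauge_nonneg[OF conic_below])

lemma upper_mono:
  assumes "agree n x y" "x n \<le> y n"
  shows "upper n x \<le> upper n y"
  unfolding upper_def cone_gauge_def using assms
  by (intro cInf_superset_mono[OF gauge_set_nonempty[OF conic_below] gauge_set_bdd])
     (force simp: gauge_set_def below_def agree_def)

lemma lower_mono:
  assumes "agree n x y" "x n \<le> y n"
  shows "lower n y \<le> lower n x"
  unfolding lower_def using assms by (intro upper_mono) (auto simp: agree_def)

lemma upper_scale: "0 < c \<Longrightarrow> upper n (\<lambda>i. c * x i) = c * upper n x"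
  by (simp add: upper_def cone_gauge_scale[OF conic_below])

lemma lower_scale: "0 < c \<Longrightarrow> lower n (\<lambda>i. c * x i) = c * lower n x"
  using upper_scale[of c n "\<lambda>i. - x i"] by (simp add: lower_def)

lemma continuous_upper: "continuous_on UNIV (upper n)"
  unfolding upper_def by (rule continuous_cone_gauge[OF conic_below])

lemma continuous_lower: "continuous_on UNIV (lower n)"
proof -
  have "continuous_on UNIV (\<lambda>x. - (x :: nat \<Rightarrow> real) i)" for i
    by (intro continuous_intros continuous_on_product_coordinates)
  then have "continuous_on UNIV (\<lambda>x i. - (x :: nat \<Rightarrow> real) i)"
    by (rule continuous_on_coordinatewise_then_product)
  from continuous_on_compose2[OF continuous_upper this] show ?thesis
    by (simp add: lower_def[abs_def])
qed

text \<open>If points of \<open>t K\<close> project to the same point as \<open>x\<close> and lie above and below \<open>x\<close>, then by convexity some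
point of \<open>t K\<close> between them agrees with \<open>x\<close> in the coordinate \<open>n\<close> too.\<close>

lemma proj_norm_Suc_eq_max: "proj_norm (Suc n) x = max (upper n x) (lower n x)"
proof (rule antisym)
  have u: "upper n y \<le> proj_norm (Suc n) y" for y
    unfolding upper_def by (rule cone_gauge_mono[OF conic_agree_Suc]) (auto simp: below_def agree_def)
  show "max (upper n x) (lower n x) \<le> proj_norm (Suc n) x"
    using u[of x] u[of "\<lambda>i. - x i"] by (simp add: lower_def proj_norm_uminus)
next
  show "proj_norm (Suc n) x \<le> max (upper n x) (lower n x)"
  proof (rule field_le_epsilon)
    fix e :: real assume e: "0 < e"
    define t where "t = max (upper n x) (lower n x) + e"
    have ut: "cone_gauge (below n) x < t" and lt: "cone_gauge (below n) (\<lambda>i. - x i) < t"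
      using e by (auto simp: t_def lower_def upper_def)
    obtain k where k: "k \<in> K" "below n x (\<lambda>i. t * k i)"
      using cone_gauge_lessD[OF conic_below ut] by blast
    obtain l where l: "l \<in> K" "below n (\<lambda>i. - x i) (\<lambda>i. t * l i)"
      using cone_gauge_lessD[OF conic_below lt] by blast
    have t: "0 < t" using cone_gauge_lessD_pos[OF conic_below ut] .
    \<comment> \<open>the point sought lies on the segment from \<open>- l\<close> to \<open>k\<close>\<close>
    have "- l n \<le> x n / t" "x n / t \<le> k n"
      using k(2) l(2) t by (auto simp: below_def field_simps)
    then have "x n / t \<in> closed_segment (- l n) (k n)"
      by (simp add: closed_segment_eq_real_ivl)
    then obtain u where "0 \<le> u" "u \<le> 1" "x n / t = (1 - u) *\<^sub>R (- l n) + u *\<^sub>R k n"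
      unfolding in_segment by blast
    then have u: "0 \<le> u" "u \<le> 1" "x n / t = u * k n + (1 - u) * (- l n)" by simp_all
    define m where "m = (\<lambda>i. u * k i + (1 - u) * (- l i))"
    have "m \<in> K" unfolding m_def using convex[OF k(1) symmetric[OF l(1)] u(1,2)] by simp
    moreover have "x i = t * m i" if "i < Suc n" for i
    proof (cases "i = n")
      case True
      then show ?thesis using u(3) t by (simp add: m_def field_simps)
    next
      case False
      then have "k i = x i / t" "l i = - x i / t"
        using k(2) l(2) t that by (auto simp: below_def agree_def field_simps)
      then have "m i = x i / t" by (simp add: m_def left_diff_distrib)
      then show ?thesis using t by simp
    qed
    ultimately have "proj_norm (Suc n) x \<le> t" using t by (intro cone_gauge_leI) (auto simp: agree_def)
    then show "proj_norm (Suc n) x \<le> max (upper n x) (lower n x) + e" by (simp add: t_def)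
  qed
qed

text \<open>A point of \<open>t K\<close> that projects to the same point as \<open>x\<close> is above or below \<open>x\<close>.\<close>

lemma proj_norm_eq_min: "proj_norm n x = min (upper n x) (lower n x)"
proof (rule antisym)
  have u: "proj_norm n y \<le> upper n y" for y
    unfolding upper_def by (rule cone_gauge_mono[OF conic_below]) (auto simp: below_def)
  show "proj_norm n x \<le> min (upper n x) (lower n x)"
    using u[of x] u[of "\<lambda>i. - x i"] by (simp add: lower_def proj_norm_uminus)
next
  show "min (upper n x) (lower n x) \<le> proj_norm n x"
  proof (rule field_le_epsilon)
    fix e :: real assume e: "0 < e"
    define t where "t = proj_norm n x + e"
    have nt: "proj_norm n x < t" using e by (simp add: t_def)
    obtain k where k: "k \<in> K" "agree n x (\<lambda>i. t * k i)"
      using cone_gauge_lessD[OF conic_agree nt] by blast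
    have t: "0 < t" using cone_gauge_lessD_pos[OF conic_agree nt] .
    have "min (upper n x) (lower n x) \<le> t"
    proof (cases "x n \<le> t * k n")
      case True
      then have "upper n x \<le> t"
        unfolding upper_def using t k by (intro cone_gauge_leI) (auto simp: below_def)
      then show ?thesis by simp
    next
      case False
      then have "lower n x \<le> t"
        unfolding lower_def upper_def using t k symmetric[OF k(1)]
        by (intro cone_gauge_leI[of _ "\<lambda>i. - k i"]) (auto simp: below_def agree_def)
      then show ?thesis by simp
    qed
    then show "min (upper n x) (lower n x) \<le> proj_norm n x + e" by (simp add: t_def)
  qed
qed

lemma coordinate_le:
  obtains b where "0 < b" "\<And>n x. i < n \<Longrightarrow> \<bar>x i\<bar> \<le> b * proj_norm n x"
proof -
  have "compact ((\<lambda>x. x i) ` K)"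
    by (intro compact_continuous_image compact continuous_on_subset[OF continuous_on_product_coordinates]) auto
  then obtain b where b: "0 < b" "\<And>k. k \<in> K \<Longrightarrow> \<bar>k i\<bar> \<le> b"
    using compact_imp_bounded bounded_pos[of "(\<lambda>x. x i) ` K"] by auto
  show thesis
  proof
    fix n and x :: "nat \<Rightarrow> real" assume "i < n"
    have "\<bar>x i\<bar> / b \<le> proj_norm n x"
    proof (rule field_le_epsilon)
      fix e :: real assume e: "0 < e"
      then have nt: "proj_norm n x < proj_norm n x + e" by simp
      obtain k where k: "k \<in> K" "agree n x (\<lambda>i. (proj_norm n x + e) * k i)"
        using cone_gauge_lessD[OF conic_agree nt] by blast
      then have "\<bar>x i\<bar> = (proj_norm n x + e) * \<bar>k i\<bar>"
        using \<open>i < n\<close> cone_gauge_lessD_pos[OF conic_agree nt] by (auto simp: agree_def abs_mult)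
      also have "\<dots> \<le> (proj_norm n x + e) * b"
        using b(2)[OF k(1)] cone_gauge_lessD_pos[OF conic_agree nt] by (intro mult_left_mono) auto
      finally show "\<bar>x i\<bar> / b \<le> proj_norm n x + e" using b(1) by (simp add: field_simps)
    qed
    then show "\<bar>x i\<bar> \<le> b * proj_norm n x" using b(1) by (simp add: field_simps)
  qed (fact b(1))
qed

lemma proj_norm_eq_zeroD: "proj_norm n x = 0 \<Longrightarrow> i < n \<Longrightarrow> x i = 0"
  by (metis coordinate_le abs_le_zero_iff mult_zero_right)

lemma proj_norm_nonneg: "0 \<le> proj_norm n x"
  by (rule cone_gauge_nonneg[OF conic_agree])

lemma proj_norm_le_one: "k \<in> K \<Longrightarrow> proj_norm n k \<le> 1"
  by (rule cone_gauge_leI) (auto simp: agree_def)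

lemma proj_norm_less_oneD: "proj_norm n x < 1 \<Longrightarrow> \<exists>k\<in>K. agree n x k"
  using cone_gauge_lessD[OF conic_agree, of n x 1] by simp

section \<open>Homeomorphisms of the projections onto cubes\<close>

text \<open>Read on the first \<open>n\<close> coordinates, \<open>\<theta>\<close> is a positively homogeneous homeomorphism of \<open>\<real>\<^sup>n\<close> that carries the
norm of the projection of \<open>K\<close> to the maximum norm. The second clause says that the maximum is attained;
it is restricted to nonzero norm because of \<open>n = 0\<close>.\<close>

definition cube_chart :: "nat \<Rightarrow> ((nat \<Rightarrow> real) \<Rightarrow> nat \<Rightarrow> real) \<Rightarrow> bool" where
  "cube_chart n \<theta> \<longleftrightarrow>
     (\<forall>x. \<forall>i<n. \<bar>\<theta> x i\<bar> \<le> proj_norm n x) \<and>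
     (\<forall>x. 0 < proj_norm n x \<longrightarrow> (\<exists>i<n. \<bar>\<theta> x i\<bar> = proj_norm n x)) \<and>
     (\<forall>i<n. continuous_on UNIV (\<lambda>x. \<theta> x i)) \<and>
     (\<forall>x y. agree n x y \<longleftrightarrow> agree n (\<theta> x) (\<theta> y)) \<and>
     (\<forall>y. \<exists>x. agree n (\<theta> x) y) \<and>
     (\<forall>c>0. \<forall>x. agree n (\<theta> (\<lambda>i. c * x i)) (\<lambda>i. c * \<theta> x i))"

lemma cube_chart_0: "cube_chart 0 (\<lambda>x i. 0)"
proof -
  have "proj_norm 0 x = 0" for x
    using proj_norm_cong[of 0 x "\<lambda>_. 0"] cone_gauge_zero[OF conic_agree] by (simp add: agree_def)
  then show ?thesis by (simp add: cube_chart_def agree_def)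
qed

text \<open>The vector \<open>w\<close> made of \<open>\<theta> x\<close> and a new component \<open>\<psi> x\<close> is rescaled so that its maximum norm \<open>Q\<close> becomes the
norm \<open>M\<close> of \<open>x\<close>. The rescaling is harmless for closeness: the estimates for \<^const>\<open>clip\<close> give
\<open>\<bar>M - Q\<bar> \<le> 2\<eta>M\<close>. The map \<open>w\<close> is injective and onto because \<open>\<psi>\<close> increases strictly in the last coordinate,
and homogeneity passes both properties on to the rescaled map.\<close>

lemma cube_chart_step:
  assumes chart: "cube_chart n \<theta>" and "0 < \<epsilon>"
  obtains \<theta>' where "cube_chart (Suc n) \<theta>'"
    "\<And>k i. k \<in> K \<Longrightarrow> i < n \<Longrightarrow> \<bar>\<theta>' k i - \<theta> k i\<bar> \<le> \<epsilon>"
proof -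
  have chart_le: "\<bar>\<theta> x i\<bar> \<le> proj_norm n x" if "i < n" for x i using chart that by (simp add: cube_chart_def)
  have chart_eq: "\<exists>i<n. \<bar>\<theta> x i\<bar> = proj_norm n x" if "0 < proj_norm n x" for x
    using chart that by (simp add: cube_chart_def)
  have chart_cont: "continuous_on UNIV (\<lambda>x. \<theta> x i)" if "i < n" for i
    using chart that by (simp add: cube_chart_def)
  have chart_agree: "agree n x y \<longleftrightarrow> agree n (\<theta> x) (\<theta> y)" for x y
    using chart unfolding cube_chart_def by blast
  have chart_surj: "\<exists>x. agree n (\<theta> x) y" for y using chart unfolding cube_chart_def by blast
  have chart_scale: "agree n (\<theta> (\<lambda>i. c * x i)) (\<lambda>i. c * \<theta> x i)" if "0 < c" for c x
    using chart that unfolding cube_chart_def by blast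

  obtain b where b: "0 < b" "\<And>m x. n < m \<Longrightarrow> \<bar>x n\<bar> \<le> b * proj_norm m x"
    using coordinate_le[of n] by metis
  define \<eta> where "\<eta> = min (1/4) (\<epsilon> / 2)"
  have \<eta>: "0 < \<eta>" "\<eta> \<le> 1/4" "2 * \<eta> \<le> \<epsilon>" using \<open>0 < \<epsilon>\<close> by (auto simp: \<eta>_def)
  define \<kappa> where "\<kappa> = \<eta> / b"
  have \<kappa>: "0 < \<kappa>" using \<eta> b by (simp add: \<kappa>_def)
  define M where "M = proj_norm (Suc n)"
  \<comment> \<open>the summand \<open>\<kappa> * x n\<close> makes \<open>\<psi>\<close> strictly increasing in the last coordinate and is at most \<open>\<eta> * M x\<close>\<close>
  define \<psi> where "\<psi> x = clip \<eta> (upper n x) (lower n x) + \<kappa> * x n" for x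
  define Q where "Q x = max (proj_norm n x) \<bar>\<psi> x\<bar>" for x
  define w where "w x i = (if i = n then \<psi> x else \<theta> x i)" for x i
  define \<theta>' where "\<theta>' x i = M x / Q x * w x i" for x i

  have M0: "0 \<le> M x" for x by (simp add: M_def proj_norm_nonneg)
  have M_max: "M x = max (upper n x) (lower n x)" for x by (simp add: M_def proj_norm_Suc_eq_max)
  have kx: "\<bar>\<kappa> * x n\<bar> \<le> \<eta> * M x" for x
    using b(2)[of "Suc n" x] b(1) \<eta>(1) by (simp add: \<kappa>_def M_def abs_mult field_simps)
  have NM: "proj_norm n x \<le> M x" for x by (simp add: M_max proj_norm_eq_min)
  have Q_le: "Q x \<le> (1 + \<eta>) * M x" for x
    using clip_bounds(1)[OF upper_nonneg[of n x] lower_nonneg[of n x], of \<eta>] \<eta> kx[of x] NM[of x]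
      mult_nonneg_nonneg[OF less_imp_le[OF \<eta>(1)] M0[of x]]
    by (auto simp: Q_def \<psi>_def M_max[symmetric] algebra_simps abs_le_iff)
  have Q_ge: "(1 - 2 * \<eta>) * M x \<le> Q x" for x
  proof -
    have "(1 - \<eta>) * M x \<le> max (proj_norm n x) \<bar>clip \<eta> (upper n x) (lower n x)\<bar>"
      using clip_bounds(2)[OF upper_nonneg[of n x] lower_nonneg[of n x], of \<eta>] \<eta>
      by (simp add: M_max proj_norm_eq_min)
    moreover have "\<bar>clip \<eta> (upper n x) (lower n x)\<bar> \<le> \<bar>\<psi> x\<bar> + \<eta> * M x"
      using kx[of x] by (simp add: \<psi>_def abs_le_iff) linarith
    moreover have "0 \<le> \<eta> * M x" using \<eta> M0 by simp
    ultimately show ?thesis by (simp add: Q_def algebra_simps)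
  qed
  have Q_pos: "0 < Q x" if "0 < M x" for x
  proof -
    have "0 < (1 - 2 * \<eta>) * M x" using \<eta> that by simp
    then show ?thesis using Q_ge[of x] by linarith
  qed
  have M_pos: "0 < M x" if "0 < Q x" for x
    using Q_le[of x] that M0[of x] by (cases "M x = 0") auto
  have w_le: "\<bar>w x i\<bar> \<le> Q x" if "i < Suc n" for x i
    using chart_le[of i x] that by (auto simp: w_def Q_def less_Suc_eq)
  have w_eq: "\<exists>i<Suc n. \<bar>w x i\<bar> = Q x" if "0 < Q x" for x
  proof (cases "proj_norm n x \<le> \<bar>\<psi> x\<bar>")
    case True
    then show ?thesis by (intro exI[of _ n]) (auto simp: w_def Q_def)
  next
    case False
    then have "0 < proj_norm n x" by simp
    then obtain i where "i < n" "\<bar>\<theta> x i\<bar> = proj_norm n x" using chart_eq by blast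
    then show ?thesis using False by (intro exI[of _ i]) (auto simp: w_def Q_def)
  qed
  have le: "\<bar>\<theta>' x i\<bar> \<le> M x" if "i < Suc n" for x i
  proof (cases "M x = 0")
    case False
    then have "0 < M x" using M0[of x] by simp
    then have "M x / Q x * \<bar>w x i\<bar> \<le> M x / Q x * Q x"
      using Q_pos[of x] w_le[OF that, of x] by (intro mult_left_mono) auto
    then show ?thesis using Q_pos[of x] \<open>0 < M x\<close> by (simp add: \<theta>'_def abs_mult)
  qed (simp add: \<theta>'_def)
  have eq: "\<exists>i<Suc n. \<bar>\<theta>' x i\<bar> = M x" if "0 < M x" for x
    using w_eq[OF Q_pos[OF that]] Q_pos[OF that] that by (auto simp: \<theta>'_def abs_mult)

  have psi_scale: "\<psi> (\<lambda>i. c * x i) = c * \<psi> x" if "0 < c" for c x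
    using clip_scale[OF that, of \<eta> "upper n x" "lower n x"]
    by (simp add: \<psi>_def upper_scale[OF that] lower_scale[OF that] distrib_left mult.left_commute)
  have w_scale: "w (\<lambda>i. c * x i) i = c * w x i" if "0 < c" "i < Suc n" for c x i
    using psi_scale[OF that(1)] chart_scale[OF that(1), of x] that(2)
    by (auto simp: w_def agree_def less_Suc_eq)
  have M_scale: "M (\<lambda>i. c * x i) = c * M x" if "0 < c" for c x
    using that by (simp add: M_def proj_norm_scale)
  have Q_scale: "Q (\<lambda>i. c * x i) = c * Q x" if "0 < c" for c x
    using that by (simp add: Q_def psi_scale proj_norm_scale abs_mult max_mult_distrib_left)
  have scale: "agree (Suc n) (\<theta>' (\<lambda>i. c * x i)) (\<lambda>i. c * \<theta>' x i)" if "0 < c" for c x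
    using that by (auto simp: agree_def \<theta>'_def M_scale Q_scale w_scale)

  have psi_less: "\<psi> x < \<psi> y" if "agree n x y" "x n < y n" for x y
  proof -
    have "clip \<eta> (upper n x) (lower n x) \<le> clip \<eta> (upper n y) (lower n y)"
      using that \<eta> by (intro clip_mono upper_mono lower_mono) auto
    then show ?thesis using that \<kappa> by (simp add: \<psi>_def add_le_less_mono)
  qed
  have w_inj: "agree (Suc n) x y" if "agree (Suc n) (w x) (w y)" for x y
  proof -
    have "agree n (\<theta> x) (\<theta> y)" using that by (auto simp: agree_def w_def less_Suc_eq split: if_splits)
    then have "agree n x y" using chart_agree by blast
    moreover have "\<psi> x = \<psi> y" using that by (auto simp: agree_def w_def)
    ultimately show ?thesis
      using psi_less[of x y] psi_less[of y x] agree_sym by (force simp: agree_Suc)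
  qed
  have w_cong: "agree (Suc n) (w x) (w y)" if xy: "agree (Suc n) x y" for x y
  proof -
    have a: "agree n x y" "x n = y n" using xy by (auto simp: agree_Suc)
    then have "upper n x = upper n y" "lower n x = lower n y"
      using upper_mono[of n x y] upper_mono[of n y x] lower_mono[of n x y] lower_mono[of n y x]
        agree_sym[OF a(1)] by (auto intro: antisym)
    then have "\<psi> x = \<psi> y" using a by (simp add: \<psi>_def)
    then show ?thesis using chart_agree[of x y] a by (auto simp: agree_def w_def)
  qed
  have cong: "agree (Suc n) (\<theta>' x) (\<theta>' y)" if xy: "agree (Suc n) x y" for x y
  proof -
    have "M x = M y" unfolding M_def by (rule proj_norm_cong[OF xy])
    moreover have "proj_norm n x = proj_norm n y" using xy by (intro proj_norm_cong) (simp add: agree_Suc)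
    then have "Q x = Q y" using w_cong[OF xy] by (auto simp: Q_def agree_def w_def)
    ultimately show ?thesis using w_cong[OF xy] by (auto simp: agree_def \<theta>'_def)
  qed
  have M_eqI: "M x \<le> M y" if "agree (Suc n) (\<theta>' x) (\<theta>' y)" for x y
  proof (cases "M x = 0")
    case False
    then obtain i where "i < Suc n" "\<bar>\<theta>' x i\<bar> = M x" using eq[of x] M0[of x] by fastforce
    then show ?thesis using le[of i y] that by (auto simp: agree_def)
  qed (simp add: M0)
  have inj: "agree (Suc n) x y" if xy: "agree (Suc n) (\<theta>' x) (\<theta>' y)" for x y
  proof -
    have Mxy: "M x = M y" using M_eqI[OF xy] M_eqI[OF agree_sym[OF xy]] by simp
    show ?thesis
    proof (cases "M x = 0")
      case True
      then show ?thesis using proj_norm_eq_zeroD[of "Suc n" x] proj_norm_eq_zeroD[of "Suc n" y] Mxy by (simp add: agree_def M_def)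
    next
      case False
      then have M: "0 < M x" "0 < M y" using M0[of x] Mxy by auto
      \<comment> \<open>the rescaled points have the same image under \<open>w\<close>\<close>
      define c d where "c = M x / Q x" and "d = M y / Q y"
      have cd: "0 < c" "0 < d" using M Q_pos by (auto simp: c_def d_def)
      have "agree (Suc n) (w (\<lambda>i. c * x i)) (w (\<lambda>i. d * y i))"
        using xy cd by (auto simp: agree_def w_scale \<theta>'_def c_def[symmetric] d_def[symmetric])
      then have a: "agree (Suc n) (\<lambda>i. c * x i) (\<lambda>i. d * y i)" by (rule w_inj)
      then have "c * M x = d * M y"
        using proj_norm_cong[OF a] M_scale[OF cd(1)] M_scale[OF cd(2)] by (simp add: M_def)
      then have "c = d" using Mxy M by simp
      then show ?thesis using a cd by (auto simp: agree_def)
    qed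
  qed

  have psi_cont: "continuous_on UNIV \<psi>"
    unfolding \<psi>_def clip_def using \<eta>(1)
    by (intro continuous_intros continuous_upper continuous_lower continuous_on_product_coordinates) auto
  have surj: "\<exists>x. agree (Suc n) (\<theta>' x) y" for y
  proof (cases "agree (Suc n) y (\<lambda>_. 0)")
    case True
    have "M (\<lambda>_. 0) = 0" unfolding M_def by (rule cone_gauge_zero[OF conic_agree])
    then show ?thesis using True by (intro exI[of _ "\<lambda>_. 0"]) (auto simp: agree_def \<theta>'_def)
  next
    case False
    \<comment> \<open>first solve \<open>w v = y\<close>, by the intermediate value theorem in the last coordinate, then rescale\<close>
    obtain z where z: "agree n (\<theta> z) y" using chart_surj by blast
    define g where "g s = \<psi> (z(n := s))" for s
    have "continuous_on UNIV (\<lambda>s. (z(n := s)))"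
    proof (rule continuous_on_coordinatewise_then_product)
      show "continuous_on UNIV (\<lambda>s. (z(n := s)) i)" for i by (cases "i = n") auto
    qed
    then have g_cont: "continuous_on UNIV g"
      unfolding g_def by (rule continuous_on_compose2[OF psi_cont]) auto
    define c where "c s = clip \<eta> (upper n (z(n := s))) (lower n (z(n := s)))" for s
    have c_mono: "c s \<le> c t" if "s \<le> t" for s t
      unfolding c_def using that \<eta> by (intro clip_mono upper_mono lower_mono) (auto simp: agree_def)
    have g_c: "g s = c s + \<kappa> * s" for s by (simp add: g_def c_def \<psi>_def)
    define r where "r = (\<bar>y n\<bar> + \<bar>c 0\<bar>) / \<kappa>"
    have r: "0 \<le> r" "\<kappa> * r = \<bar>y n\<bar> + \<bar>c 0\<bar>" using \<kappa> by (auto simp: r_def)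
    have "g (- r) \<le> y n" "y n \<le> g r"
      using c_mono[of "- r" 0] c_mono[of 0 r] r by (auto simp: g_c)
    then obtain s where s: "g s = y n"
      using IVT'[of g "- r" "y n" r] r continuous_on_subset[OF g_cont] by auto
    define v where "v = z(n := s)"
    have wv: "agree (Suc n) (w v) y"
    proof -
      have "agree n (\<theta> v) (\<theta> z)" using chart_agree[of v z] by (simp add: v_def agree_def)
      then show ?thesis using z s by (auto simp: agree_def w_def less_Suc_eq v_def g_def)
    qed
    have "Q v \<noteq> 0"
    proof
      assume "Q v = 0"
      then have "w v i = 0" if "i < Suc n" for i using w_le[OF that, of v] by simp
      then show False using False wv by (auto simp: agree_def)
    qed
    moreover have "0 \<le> Q v" unfolding Q_def by (simp add: max.coboundedI2)
    ultimately have Qv: "0 < Q v" by simp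
    have Mv: "0 < M v" by (rule M_pos[OF Qv])
    define d where "d = Q v / M v"
    have d: "0 < d" using Qv Mv by (simp add: d_def)
    have "\<theta>' (\<lambda>i. d * v i) i = y i" if "i < Suc n" for i
    proof -
      have "\<theta>' (\<lambda>i. d * v i) i = M v / Q v * (d * w v i)"
        using d that by (simp add: \<theta>'_def M_scale Q_scale w_scale)
      also have "\<dots> = w v i" using Qv Mv by (simp add: d_def)
      finally show ?thesis using wv that by (simp add: agree_def)
    qed
    then show ?thesis by (auto simp: agree_def)
  qed

  have M_cont: "continuous_on UNIV M" unfolding M_def by (rule continuous_cone_gauge[OF conic_agree])
  have cont: "continuous_on UNIV (\<lambda>x. \<theta>' x i)" if i: "i < Suc n" for i
    unfolding continuous_on_eq_continuous_at[OF open_UNIV]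
  proof
    fix x
    have w_cont: "isCont (\<lambda>x. w x i) x"
      using psi_cont chart_cont[of i] i
      by (cases "i = n") (auto simp: w_def continuous_on_eq_continuous_at)
    have Q_cont: "isCont Q x"
      using psi_cont continuous_cone_gauge[OF conic_agree, of n]
      unfolding Q_def continuous_on_eq_continuous_at[OF open_UNIV] by (intro continuous_intros) auto
    have Mx: "isCont M x" using M_cont by (simp add: continuous_on_eq_continuous_at)
    show "isCont (\<lambda>x. \<theta>' x i) x"
    proof (cases "M x = 0")
      case True
      have "(M \<longlongrightarrow> 0) (at x)" using Mx True by (simp add: isCont_def)
      then have "((\<lambda>y. \<theta>' y i) \<longlongrightarrow> 0) (at x)"
        by (rule Lim_null_comparison[rotated]) (use le[OF i] in auto)
      then show ?thesis using True by (simp add: isCont_def \<theta>'_def)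
    next
      case False
      then have "Q x \<noteq> 0" using Q_pos[of x] M0[of x] by force
      then show ?thesis unfolding \<theta>'_def by (intro continuous_intros Mx Q_cont w_cont)
    qed
  qed

  have close: "\<bar>\<theta>' k i - \<theta> k i\<bar> \<le> \<epsilon>" if k: "k \<in> K" and i: "i < n" for k i
  proof (cases "M k = 0")
    case True
    then have "\<theta> k i = 0" using chart_le[OF i, of k] NM[of k] by simp
    then show ?thesis using True \<open>0 < \<epsilon>\<close> by (simp add: \<theta>'_def)
  next
    case False
    then have Q: "0 < Q k" using Q_pos[of k] M0[of k] by force
    have wi: "w k i = \<theta> k i" using i by (simp add: w_def)
    have "\<theta>' k i - \<theta> k i = (M k - Q k) * (\<theta> k i / Q k)"
      using Q wi by (simp add: \<theta>'_def field_simps)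
    then have "\<bar>\<theta>' k i - \<theta> k i\<bar> = \<bar>M k - Q k\<bar> * (\<bar>\<theta> k i\<bar> / Q k)"
      using Q by (simp add: abs_mult)
    also have "\<dots> \<le> \<bar>M k - Q k\<bar> * 1"
      using Q w_le[of i k] i wi by (intro mult_left_mono) auto
    also have "\<dots> \<le> 2 * \<eta> * M k"
      using Q_le[of k] Q_ge[of k] mult_nonneg_nonneg[OF less_imp_le[OF \<eta>(1)] M0[of k]]
      by (auto simp: abs_le_iff algebra_simps)
    also have "\<dots> \<le> 2 * \<eta> * 1"
      using \<eta> proj_norm_le_one[OF k, of "Suc n"] by (intro mult_left_mono) (auto simp: M_def)
    finally show ?thesis using \<eta> by simp
  qed
  show thesis
  proof (rule that[of \<theta>'])
    show "cube_chart (Suc n) \<theta>'"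
      unfolding cube_chart_def M_def[symmetric]
      using le eq cont inj cong surj scale by blast
  qed (use close in auto)
qed

section \<open>Keller's theorem for symmetric sets\<close>

text \<open>An injective continuous map on a compact set has a modulus of injectivity. The bound \<open>1 / (n + 1)\<close>
shrinks with \<open>n\<close>, so that finally every pair of distinct points is detected.\<close>

lemma cube_chart_modulus:
  assumes chart: "cube_chart n \<theta>"
  obtains \<delta> where "0 < \<delta>"
    "\<And>x y. \<lbrakk>x \<in> K; y \<in> K; \<forall>i<n. \<bar>\<theta> x i - \<theta> y i\<bar> < \<delta>\<rbrakk> \<Longrightarrow> \<forall>i<n. \<bar>x i - y i\<bar> < 1 / Suc n"
proof -
  define S where "S = (\<Union>i<n. (K \<times> K) \<inter> {p. 1 / Suc n \<le> \<bar>fst p i - snd p i\<bar>})"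
  define f where "f p = (\<Sum>i<n. \<bar>\<theta> (fst p) i - \<theta> (snd p) i\<bar>)" for p
  have cont: "continuous_on UNIV (\<lambda>x. \<theta> x i)" if "i < n" for i
    using chart that by (simp add: cube_chart_def)
  have "compact S"
    unfolding S_def
  proof (intro compact_UN compact_Int_closed compact_Times compact closed_Collect_le)
    show "continuous_on UNIV (\<lambda>p :: (nat \<Rightarrow> real) \<times> (nat \<Rightarrow> real). \<bar>fst p i - snd p i\<bar>)" for i
      by (intro continuous_intros continuous_on_compose2[OF continuous_on_product_coordinates]) auto
  qed (auto intro: continuous_on_const)
  moreover have "continuous_on S f"
    unfolding f_def
    by (intro continuous_intros continuous_on_compose2[OF cont]) auto
  moreover have pos: "0 < f p" if "p \<in> S" for p
  proof -
    have "\<not> agree n (fst p) (snd p)" using that by (fastforce simp: S_def agree_def)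
    then have "\<not> agree n (\<theta> (fst p)) (\<theta> (snd p))" using chart unfolding cube_chart_def by blast
    then obtain i where "i < n" "\<theta> (fst p) i \<noteq> \<theta> (snd p) i" by (auto simp: agree_def)
    then show ?thesis unfolding f_def by (intro sum_pos2[of _ i]) auto
  qed
  ultimately obtain c where c: "0 < c" "\<And>p. p \<in> S \<Longrightarrow> c \<le> f p"
    by (metis continuous_attains_inf zero_less_one ex_in_conv)
  show thesis
  proof (rule that[of "c / Suc n"])
    show "0 < c / Suc n" using c by simp
    fix x y assume xy: "x \<in> K" "y \<in> K" and close: "\<forall>i<n. \<bar>\<theta> x i - \<theta> y i\<bar> < c / Suc n"
    have "f (x, y) \<le> (\<Sum>i<n. c / Suc n)" using close unfolding f_def by (intro sum_mono) auto
    also have "\<dots> < c" using c(1) by (simp add: field_simps)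
    finally have "(x, y) \<notin> S" using c(2) by force
    then show "\<forall>i<n. \<bar>x i - y i\<bar> < 1 / Suc n" using xy by (auto simp: S_def not_le)
  qed
qed

text \<open>The limit of charts \<open>\<theta>\<^sub>n\<close> with moduli \<open>d\<^sub>n\<close>, where \<open>d\<^sub>n\<^sub>+\<^sub>1 \<le> d\<^sub>n / 2\<close> and consecutive charts differ by at most
\<open>d\<^sub>n / 8\<close>. The differences after stage \<open>n\<close> then add up to at most \<open>d\<^sub>n / 4\<close>, and two points that \<open>\<theta>\<^sub>n\<close> separates
by \<open>d\<^sub>n\<close> stay separated in the limit.\<close>

lemma homeomorphic_hilbert_cube: "top_of_set K homeomorphic_space hilbert_cube"
proof -
  define P where "P n p \<longleftrightarrow> cube_chart n (fst p) \<and> 0 < snd p \<and> snd p \<le> (1/2) ^ n \<and>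
    (\<forall>x\<in>K. \<forall>y\<in>K. (\<forall>i<n. \<bar>fst p x i - fst p y i\<bar> < snd p) \<longrightarrow> (\<forall>i<n. \<bar>x i - y i\<bar> < 1 / Suc n))"
    for n and p :: "((nat \<Rightarrow> real) \<Rightarrow> nat \<Rightarrow> real) \<times> real"
  define R where "R n p q \<longleftrightarrow> snd q \<le> snd p / 2 \<and>
    (\<forall>k\<in>K. \<forall>i<n. \<bar>fst q k i - fst p k i\<bar> \<le> snd p / 8)"
    for n and p q :: "((nat \<Rightarrow> real) \<Rightarrow> nat \<Rightarrow> real) \<times> real"
  have "\<exists>s. \<forall>n. P n (s n) \<and> R n (s n) (s (Suc n))"
  proof (rule dependent_nat_choice)
    show "\<exists>p. P 0 p"
      by (intro exI[of _ "(\<lambda>x i. 0, 1)"]) (simp add: P_def cube_chart_0)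
    fix p n assume p: "P n p"
    then have "cube_chart n (fst p)" "0 < snd p / 8" by (auto simp: P_def)
    from cube_chart_step[OF this] obtain \<theta> where \<theta>: "cube_chart (Suc n) \<theta>"
      "\<And>k i. k \<in> K \<Longrightarrow> i < n \<Longrightarrow> \<bar>\<theta> k i - fst p k i\<bar> \<le> snd p / 8" by metis
    obtain \<delta> where \<delta>: "0 < \<delta>" "\<And>x y. \<lbrakk>x \<in> K; y \<in> K; \<forall>i<Suc n. \<bar>\<theta> x i - \<theta> y i\<bar> < \<delta>\<rbrakk>
        \<Longrightarrow> \<forall>i<Suc n. \<bar>x i - y i\<bar> < 1 / Suc (Suc n)"
      using cube_chart_modulus[OF \<theta>(1)] by metis
    define d where "d = min \<delta> (snd p / 2)"
    have "P (Suc n) (\<theta>, d)"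
      using \<theta>(1) \<delta> p by (auto simp: P_def d_def min_le_iff_disj)
    moreover have "R n p (\<theta>, d)" using \<theta>(2) by (auto simp: R_def d_def)
    ultimately show "\<exists>q. P (Suc n) q \<and> R n p q" by blast
  qed
  then obtain s where s: "\<And>n. P n (s n)" "\<And>n. R n (s n) (s (Suc n))" by blast
  define \<theta> d where "\<theta> n = fst (s n)" and "d n = snd (s n)" for n
  have chart: "cube_chart n (\<theta> n)" and d_pos: "0 < d n" and d_le: "d n \<le> (1/2) ^ n" for n
    using s(1)[of n] by (auto simp: P_def \<theta>_def d_def)
  have modulus: "\<bar>x i - y i\<bar> < 1 / Suc n"
    if "x \<in> K" "y \<in> K" "\<And>i. i < n \<Longrightarrow> \<bar>\<theta> n x i - \<theta> n y i\<bar> < d n" "i < n" for n x y i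
    using s(1)[of n] that unfolding P_def \<theta>_def d_def by blast
  have d_half: "d (Suc n) \<le> d n / 2" and
    close1: "\<And>k i. k \<in> K \<Longrightarrow> i < n \<Longrightarrow> \<bar>\<theta> (Suc n) k i - \<theta> n k i\<bar> \<le> d n / 8" for n
    using s(2)[of n] by (auto simp: R_def \<theta>_def d_def)
  have d_geometric: "d (n + j) \<le> d n * (1/2) ^ j" for n j
  proof (induction j)
    case (Suc j)
    then show ?case using d_half[of "n + j"] by simp
  qed simp
  have close_aux: "\<bar>\<theta> (n + j) k i - \<theta> n k i\<bar> \<le> d n / 4 * (1 - (1/2) ^ j)"
    if "k \<in> K" "i < n" for n j k i
  proof (induction j)
    case (Suc j)
    have "\<bar>\<theta> (n + Suc j) k i - \<theta> (n + j) k i\<bar> \<le> d n * (1/2) ^ j / 8"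
      using close1[OF that(1), of i "n + j"] that(2) d_geometric[of n j] by simp
    then have "\<bar>\<theta> (n + Suc j) k i - \<theta> n k i\<bar> \<le> d n * (1/2) ^ j / 8 + d n / 4 * (1 - (1/2) ^ j)"
      using Suc by linarith
    also have "\<dots> = d n / 4 * (1 - (1/2) ^ Suc j)" by (simp add: algebra_simps)
    finally show ?case .
  qed simp
  have close: "\<bar>\<theta> m k i - \<theta> n k i\<bar> \<le> d n / 4" if "k \<in> K" "i < n" "n \<le> m" for m n k i
  proof -
    have "d n / 4 * (1 - (1/2) ^ (m - n)) \<le> d n / 4 * 1"
      using d_pos[of n] by (intro mult_left_mono) auto
    then show ?thesis using close_aux[OF that(1,2), of "m - n"] that(3) by simp
  qed
  have d_lim: "d \<longlonglongrightarrow> 0"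
  proof (rule tendsto_sandwich[OF _ _ tendsto_const])
    show "(\<lambda>n. (1/2 :: real) ^ n) \<longlonglongrightarrow> 0" by (rule LIMSEQ_realpow_zero) auto
  qed (auto intro!: always_eventually less_imp_le[OF d_pos] d_le)
  define T where "T k i = lim (\<lambda>n. \<theta> n k i)" for k i
  have T_lim: "(\<lambda>n. \<theta> n k i) \<longlonglongrightarrow> T k i" if "k \<in> K" for k i
  proof -
    have "Cauchy (\<lambda>n. \<theta> n k i)"
    proof (rule CauchyI')
      fix e :: real assume "0 < e"
      then obtain n0 where n0: "\<And>n. n0 \<le> n \<Longrightarrow> \<bar>d n\<bar> < e"
        using LIMSEQ_D[OF d_lim, of e] by auto
      show "\<exists>M. \<forall>m\<ge>M. \<forall>n>m. dist (\<theta> m k i) (\<theta> n k i) < e"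
      proof (intro exI allI impI)
        fix m n assume "max n0 (Suc i) \<le> m" "m < n"
        then show "dist (\<theta> m k i) (\<theta> n k i) < e"
          using close[OF that, of i m n] n0[of m] d_pos[of m] by (simp add: dist_real_def abs_minus_commute)
      qed
    qed
    then show ?thesis unfolding T_def by (simp add: Cauchy_convergent_iff convergent_LIMSEQ_iff)
  qed
  have T_close: "\<bar>T k i - \<theta> n k i\<bar> \<le> d n / 4" if "k \<in> K" "i < n" for k i n
  proof (rule tendsto_upperbound)
    show "((\<lambda>m. \<bar>\<theta> m k i - \<theta> n k i\<bar>) \<longlongrightarrow> \<bar>T k i - \<theta> n k i\<bar>) sequentially"
      by (intro tendsto_intros T_lim that)
    show "\<forall>\<^sub>F m in sequentially. \<bar>\<theta> m k i - \<theta> n k i\<bar> \<le> d n / 4"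
      using close[OF that] eventually_sequentially by auto
  qed simp
  have T_cont: "continuous_on K (\<lambda>k. T k i)" for i
  proof (rule uniform_limit_theorem)
    show "uniform_limit K (\<lambda>n k. \<theta> n k i) (\<lambda>k. T k i) sequentially"
    proof (rule uniform_limitI)
      fix e :: real assume "0 < e"
      then obtain n0 where n0: "\<And>n. n0 \<le> n \<Longrightarrow> \<bar>d n\<bar> < e"
        using LIMSEQ_D[OF d_lim, of e] by auto
      have "dist (\<theta> n k i) (T k i) < e" if "max n0 (Suc i) \<le> n" "k \<in> K" for n k
        using T_close[OF that(2), of i n] n0[of n] d_pos[of n] that(1)
        by (simp add: dist_real_def abs_minus_commute)
      then show "\<forall>\<^sub>F n in sequentially. \<forall>k\<in>K. dist (\<theta> n k i) (T k i) < e"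
        using eventually_sequentially by blast
    qed
    have "continuous_on K (\<lambda>k. \<theta> n k i)" if "Suc i \<le> n" for n
      using chart[of n] that unfolding cube_chart_def
      by (meson Suc_le_lessD continuous_on_subset subset_UNIV)
    then show "\<forall>\<^sub>F n in sequentially. continuous_on K (\<lambda>k. \<theta> n k i)"
      using eventually_sequentially by blast
  qed auto
  then have cont: "continuous_on K T" by (rule continuous_on_coordinatewise_then_product)
  define C where "C = {y :: nat \<Rightarrow> real. \<forall>i. y i \<in> {-1..1}}"
  have T_le: "\<bar>T k i\<bar> \<le> 1" if "k \<in> K" for k i
  proof (rule tendsto_upperbound)
    show "((\<lambda>n. \<bar>\<theta> n k i\<bar>) \<longlongrightarrow> \<bar>T k i\<bar>) sequentially" by (intro tendsto_intros T_lim that)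
    have "\<bar>\<theta> n k i\<bar> \<le> 1" if "Suc i \<le> n" for n
    proof -
      have "\<bar>\<theta> n k i\<bar> \<le> proj_norm n k" using chart[of n] that by (auto simp: cube_chart_def)
      then show ?thesis using proj_norm_le_one[OF \<open>k \<in> K\<close>, of n] by linarith
    qed
    then show "\<forall>\<^sub>F n in sequentially. \<bar>\<theta> n k i\<bar> \<le> 1" using eventually_sequentially by blast
  qed simp
  have "T ` K \<subseteq> C" using T_le by (auto simp: C_def abs_le_iff minus_le_iff)
  moreover have "C \<subseteq> T ` K"
  proof
    fix y assume y: "y \<in> C"
    \<comment> \<open>a norm strictly below \<open>1\<close> yields a point of \<open>K\<close> directly; the factor tends to \<open>1\<close>\<close>
    have "\<exists>k\<in>K. agree n (\<theta> n k) (\<lambda>i. (1 - 1 / Suc n) * y i)" for n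
    proof -
      obtain x where x: "agree n (\<theta> n x) (\<lambda>i. (1 - 1 / Suc n) * y i)"
        using chart[of n] unfolding cube_chart_def by blast
      have "proj_norm n x < 1"
      proof (cases "0 < proj_norm n x")
        case True
        then obtain i where i: "i < n" "\<bar>\<theta> n x i\<bar> = proj_norm n x"
          using chart[of n] unfolding cube_chart_def by blast
        have "proj_norm n x = (1 - 1 / Suc n) * \<bar>y i\<bar>"
          using x i by (auto simp: agree_def abs_mult)
        also have "\<dots> \<le> (1 - 1 / Suc n) * 1"
          using y by (intro mult_left_mono) (auto simp: C_def abs_le_iff minus_le_iff)
        also have "\<dots> < 1" by simp
        finally show ?thesis .
      qed simp
      then obtain k where k: "k \<in> K" "agree n x k" using proj_norm_less_oneD by blast
      then have "agree n (\<theta> n k) (\<theta> n x)"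
        using chart[of n] agree_sym unfolding cube_chart_def by blast
      then show ?thesis using k(1) x agree_trans by blast
    qed
    then obtain k where k: "\<And>n. k n \<in> K" "\<And>n. agree n (\<theta> n (k n)) (\<lambda>i. (1 - 1 / Suc n) * y i)"
      by metis
    have "(\<lambda>n. T (k n) i) \<longlonglongrightarrow> y i" for i
    proof -
      have lim: "(\<lambda>n. (1 - 1 / real (Suc n)) * y i) \<longlonglongrightarrow> (1 - 0) * y i"
        using LIMSEQ_inverse_real_of_nat
        by (intro tendsto_intros) (simp add: inverse_eq_divide)
      have "(\<lambda>n. T (k n) i - (1 - 1 / real (Suc n)) * y i) \<longlonglongrightarrow> 0"
      proof (rule Lim_null_comparison)
        show "(\<lambda>n. d n / 4) \<longlonglongrightarrow> 0" using tendsto_divide[OF d_lim tendsto_const[of 4]] by simp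
        have "norm (T (k n) i - (1 - 1 / real (Suc n)) * y i) \<le> d n / 4" if "Suc i \<le> n" for n
          using T_close[OF k(1)[of n], of i n] k(2)[of n] that by (simp add: agree_def)
        then show "\<forall>\<^sub>F n in sequentially. norm (T (k n) i - (1 - 1 / real (Suc n)) * y i) \<le> d n / 4"
          using eventually_sequentially by blast
      qed
      from tendsto_add[OF this lim] show ?thesis by simp
    qed
    then have "(\<lambda>n. T (k n)) \<longlonglongrightarrow> y" by (rule tendsto_coordinatewise)
    moreover have "closed (T ` K)"
      by (intro compact_imp_closed compact_continuous_image cont compact)
    ultimately show "y \<in> T ` K" using k(1) by (auto intro: closed_sequentially[of "T ` K" "\<lambda>n. T (k n)"])
  qed
  ultimately have image: "T ` K = C" by blast
  have inj: "inj_on T K"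
  proof (rule inj_onI, rule ccontr)
    fix x y assume xy: "x \<in> K" "y \<in> K" "T x = T y" "x \<noteq> y"
    then obtain i where "x i \<noteq> y i" by blast
    then obtain m where m: "1 / real (Suc m) < \<bar>x i - y i\<bar>"
      using reals_Archimedean[of "\<bar>x i - y i\<bar>"] by (auto simp: inverse_eq_divide)
    define n where "n = max m (Suc i)"
    have n: "i < n" "m \<le> n" by (auto simp: n_def)
    have "\<bar>\<theta> n x j - \<theta> n y j\<bar> < d n" if "j < n" for j
    proof -
      have "T x j = T y j" using xy(3) by simp
      then show ?thesis
        using T_close[OF xy(1) that] T_close[OF xy(2) that] d_pos[of n] by linarith
    qed
    then have "\<bar>x i - y i\<bar> < 1 / Suc n" using modulus[OF xy(1,2)] n by blast
    also have "\<dots> \<le> 1 / Suc m" using n by (intro divide_left_mono) auto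
    finally show False using m by simp
  qed
  have cube: "hilbert_cube = top_of_set C"
  proof -
    have "hilbert_cube = subtopology (product_topology (\<lambda>_. euclidean) UNIV) (Pi\<^sub>E UNIV (\<lambda>_. {-1..1}))"
      unfolding hilbert_cube_def by (simp add: subtopology_product_topology)
    also have "Pi\<^sub>E UNIV (\<lambda>_. {-1..1}) = C" by (auto simp: C_def PiE_iff)
    finally show ?thesis by (simp add: euclidean_product_topology)
  qed
  have "homeomorphic_map (top_of_set K) (top_of_set C) T"
  proof (rule continuous_imp_homeomorphic_map)
    show "continuous_map (top_of_set K) (top_of_set C) T"
      using cont image by (auto simp: continuous_map_in_subtopology)
    show "compact_space (top_of_set K)" using compact by (simp add: compact_space_subtopology)
    show "Hausdorff_space (top_of_set C)"
      by (intro Hausdorff_space_subtopology) (simp add: Hausdorff_space_euclidean)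
  qed (use image inj in auto)
  then show ?thesis unfolding cube by (rule homeomorphic_map_imp_homeomorphic_space)
qed

end

text \<open>Only the pivots are kept: the coordinates that can be the first nonzero coordinate of a point of \<open>L\<close>.
Half the difference of two points of \<open>L\<close> belongs to \<open>L\<close> and, unless zero, is nonzero at a pivot, so pivots
separate points. Points with prescribed pivot form a triangular system, from which every
vector can be combined on the first \<open>n\<close> pivots.\<close>

theorem keller_symmetric:
  fixes L :: "(nat \<Rightarrow> real) set"
  assumes compact_L: "compact L"
    and convex_L: "\<And>x y u. \<lbrakk>x \<in> L; y \<in> L; 0 \<le> u; u \<le> 1\<rbrakk> \<Longrightarrow> (\<lambda>i. u * x i + (1 - u) * y i) \<in> L"
    and symmetric_L: "\<And>x. x \<in> L \<Longrightarrow> (\<lambda>i. - x i) \<in> L"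
    and infinite_dim: "\<And>n. \<exists>x\<in>L. x \<noteq> (\<lambda>_. 0) \<and> (\<forall>i<n. x i = 0)"
  shows "top_of_set L homeomorphic_space hilbert_cube"
proof -
  define J where "J = {j. \<exists>x\<in>L. x j \<noteq> 0 \<and> (\<forall>i<j. x i = 0)}"
  have pivot: "\<exists>j\<in>J. x j \<noteq> 0 \<and> (\<forall>i<j. x i = 0)" if "x \<in> L" "x \<noteq> (\<lambda>_. 0)" for x
  proof -
    have "\<exists>j. x j \<noteq> 0" using that(2) by auto
    then have "x (LEAST j. x j \<noteq> 0) \<noteq> 0" "\<forall>i<(LEAST j. x j \<noteq> 0). x i = 0"
      using LeastI_ex not_less_Least by (metis (mono_tags, lifting))+
    then show ?thesis unfolding J_def using that(1) by blast
  qed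
  have "infinite J"
    unfolding infinite_nat_iff_unbounded_le
  proof
    fix n
    obtain x where "x \<in> L" "x \<noteq> (\<lambda>_. 0)" "\<forall>i<n. x i = 0" using infinite_dim by blast
    then obtain j where "j \<in> J" "x j \<noteq> 0" using pivot by blast
    then show "\<exists>j\<ge>n. j \<in> J" using \<open>\<forall>i<n. x i = 0\<close> by (metis not_le)
  qed
  define m where "m = enumerate J"
  have m_mono: "strict_mono m" and m_range: "range m = J"
    using \<open>infinite J\<close> by (simp_all add: m_def strict_mono_enumerate range_enumerate)
  define \<rho> where "\<rho> x = (\<lambda>i. x (m i))" for x :: "nat \<Rightarrow> real"
  define K where "K = \<rho> ` L"
  have cont: "continuous_on L \<rho>"
    unfolding \<rho>_def
    by (intro continuous_on_coordinatewise_then_product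
        continuous_on_subset[OF continuous_on_product_coordinates]) auto
  interpret symmetric_body K
  proof
    show "compact K" unfolding K_def by (intro compact_continuous_image cont compact_L)
    show K_convex: "(\<lambda>i. u * x i + (1 - u) * y i) \<in> K" if "x \<in> K" "y \<in> K" "0 \<le> u" "u \<le> 1" for x y u
      using that convex_L unfolding K_def \<rho>_def by fastforce
    show K_sym: "(\<lambda>i. - x i) \<in> K" if "x \<in> K" for x
      using that symmetric_L unfolding K_def \<rho>_def by fastforce
    show "\<exists>t>0. \<exists>k\<in>K. agree n x (\<lambda>i. t * k i)" for n x
    proof (induction n)
      case 0
      obtain y where "y \<in> L" using infinite_dim by blast
      then show ?case by (intro exI[of _ 1]) (auto simp: agree_def K_def)
    next
      case (Suc n)
      then obtain t k where t: "0 < t" "k \<in> K" "agree n x (\<lambda>i. t * k i)" by blast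
      obtain y where y: "y \<in> L" "y (m n) \<noteq> 0" "\<forall>i<m n. y i = 0"
        using m_range unfolding J_def by blast
      define e where "e = \<rho> y"
      have e: "e \<in> K" "e n \<noteq> 0" "\<And>i. i < n \<Longrightarrow> e i = 0"
        using y m_mono by (auto simp: e_def K_def \<rho>_def strict_mono_less)
      \<comment> \<open>the multiple of \<open>e\<close> that corrects the coordinate \<open>n\<close> and leaves the earlier ones alone\<close>
      define r where "r = (x n - t * k n) / e n"
      define l where "l = (\<lambda>i. sgn r * e i)"
      have l: "l \<in> K" if "r \<noteq> 0"
        using e(1) K_sym[OF e(1)] that by (cases "r > 0") (auto simp: l_def)
      show ?case
      proof (cases "r = 0")
        case True
        then have "agree (Suc n) x (\<lambda>i. t * k i)"
          using t(3) e(2) by (auto simp: r_def agree_def less_Suc_eq)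
        then show ?thesis using t by blast
      next
        case False
        define s where "s = t + \<bar>r\<bar>"
        have s: "0 < s" using t by (simp add: s_def add_pos_nonneg)
        define k' where "k' = (\<lambda>i. t / s * k i + (1 - t / s) * l i)"
        have "k' \<in> K" unfolding k'_def using t s l[OF False] by (intro K_convex) (auto simp: s_def)
        moreover have "x i = s * k' i" if "i < Suc n" for i
        proof -
          have "s * (1 - t / s) = \<bar>r\<bar>" using s by (simp add: s_def field_simps)
          then have "s * k' i = t * k i + \<bar>r\<bar> * l i"
            using s by (simp add: k'_def distrib_left flip: mult.assoc)
          also have "\<bar>r\<bar> * l i = r * e i" by (simp add: l_def abs_mult_sgn flip: mult.assoc)
          also have "t * k i + r * e i = x i"
            using that t(3) e(2,3) by (auto simp: r_def agree_def less_Suc_eq)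
          finally show ?thesis by simp
        qed
        ultimately show ?thesis using s by (auto simp: agree_def)
      qed
    qed
  qed
  have inj: "inj_on \<rho> L"
  proof (rule inj_onI, rule ccontr)
    fix x y assume xy: "x \<in> L" "y \<in> L" "\<rho> x = \<rho> y" "x \<noteq> y"
    define z where "z = (\<lambda>i. 1/2 * x i + (1 - 1/2) * (- y i))"
    have "z \<in> L" unfolding z_def using xy symmetric_L by (intro convex_L) auto
    moreover have "z \<noteq> (\<lambda>_. 0)"
    proof
      assume z0: "z = (\<lambda>_. 0)"
      have "x i = y i" for i using fun_cong[OF z0, of i] by (simp add: z_def)
      then show False using xy(4) by blast
    qed
    ultimately obtain j where "j \<in> J" "z j \<noteq> 0" using pivot by blast
    then obtain i where "z (m i) \<noteq> 0" using m_range by blast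
    then show False using fun_cong[OF xy(3), of i] by (simp add: z_def \<rho>_def)
  qed
  have "homeomorphic_map (top_of_set L) (top_of_set K) \<rho>"
  proof (rule continuous_imp_homeomorphic_map)
    show "continuous_map (top_of_set L) (top_of_set K) \<rho>"
      using cont by (auto simp: continuous_map_in_subtopology K_def)
    show "compact_space (top_of_set L)" using compact_L by (simp add: compact_space_subtopology)
    show "Hausdorff_space (top_of_set K)" by (intro Hausdorff_space_subtopology) simp
  qed (use inj in \<open>auto simp: K_def\<close>)
  then have "top_of_set L homeomorphic_space top_of_set K"
    by (rule homeomorphic_map_imp_homeomorphic_space)
  then show ?thesis using homeomorphic_hilbert_cube by (rule homeomorphic_space_trans)
qed

section \<open>The Hahn-Banach theorem\<close>

text \<open>Partial functionals are represented by their graphs, so that inclusion orders them by extension. The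
bound at \<open>x = 0\<close> makes such a subspace single-valued.\<close>

definition linear_graph :: "real \<Rightarrow> ('a::real_normed_vector \<times> real) set \<Rightarrow> bool" where
  "linear_graph c G \<longleftrightarrow> subspace G \<and> (\<forall>x r. (x, r) \<in> G \<longrightarrow> \<bar>r\<bar> \<le> c * norm x)"

lemma linear_graph_unique:
  assumes "linear_graph c G" "(x, r) \<in> G" "(x, s) \<in> G"
  shows "r = s"
proof -
  have "(x, r) - (x, s) \<in> G" using assms subspace_diff unfolding linear_graph_def by blast
  then have "\<bar>r - s\<bar> \<le> c * norm (0 :: 'a)" using assms(1) unfolding linear_graph_def by force
  then show ?thesis by simp
qed

text \<open>A value \<open>r\<close> at \<open>z\<close> is admissible if it lies between \<open>- s - c \<parallel>x + z\<parallel>\<close> and \<open>c \<parallel>y + z\<parallel> - t\<close> for all \<open>(x, s)\<close> and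
\<open>(y, t)\<close> in the graph. Each lower bound is at most each upper bound by the triangle inequality, and
homogeneity takes care of the remaining multiples of \<open>z\<close>.\<close>

lemma linear_graph_extend:
  fixes z :: "'a::real_normed_vector"
  assumes G: "linear_graph c G" and c: "0 \<le> c"
  shows "\<exists>G' r. linear_graph c G' \<and> G \<subseteq> G' \<and> (z, r) \<in> G'"
proof -
  have sub: "subspace G" and bound: "\<And>x r. (x, r) \<in> G \<Longrightarrow> \<bar>r\<bar> \<le> c * norm x"
    using G by (auto simp: linear_graph_def)
  have zero: "(0, 0) \<in> G" using subspace_0[OF sub] by (simp add: zero_prod_def)
  have sep: "- s - c * norm (x + z) \<le> c * norm (y + z) - t" if "(x, s) \<in> G" "(y, t) \<in> G" for x s y t
  proof -
    have "(y, t) - (x, s) \<in> G" using that sub by (intro subspace_diff)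
    then have "\<bar>t - s\<bar> \<le> c * norm (y - x)" using bound by simp
    also have "\<dots> \<le> c * (norm (y + z) + norm (x + z))"
      using norm_triangle_ineq4[of "y + z" "x + z"] c by (intro mult_left_mono) (auto simp: algebra_simps)
    finally show ?thesis by (simp add: algebra_simps)
  qed
  define L where "L = (\<lambda>(x, s). - s - c * norm (x + z)) ` G"
  define r where "r = Sup L"
  have "L \<noteq> {}" using zero by (auto simp: L_def)
  moreover have bdd: "bdd_above L"
    using sep[OF _ zero] by (intro bdd_aboveI[of _ "c * norm (0 + z) - 0"]) (auto simp: L_def)
  ultimately have r_le: "r \<le> c * norm (y + z) - t" if "(y, t) \<in> G" for y t
    unfolding r_def using sep[OF _ that] by (intro cSup_least) (auto simp: L_def)
  have r_ge: "- s - c * norm (x + z) \<le> r" if "(x, s) \<in> G" for x s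
    unfolding r_def using that by (intro cSup_upper[OF _ bdd]) (force simp: L_def)
  have r: "\<bar>s + r\<bar> \<le> c * norm (x + z)" if "(x, s) \<in> G" for x s
    using r_le[OF that] r_ge[OF that] by (simp add: abs_le_iff)
  define G' where "G' = {p + q |p q. p \<in> G \<and> q \<in> span {(z, r)}}"
  have "subspace G'" unfolding G'_def by (intro subspace_sums sub subspace_span)
  moreover have "\<bar>t\<bar> \<le> c * norm y" if yt: "(y, t) \<in> G'" for y t
  proof -
    obtain x s a where xs: "(x, s) \<in> G" "y = x + a *\<^sub>R z" "t = s + a * r"
      using yt by (auto simp: G'_def span_singleton)
    show ?thesis
    proof (cases "a = 0")
      case True
      then show ?thesis using bound[OF xs(1)] xs by simp
    next
      case False
      have "inverse a *\<^sub>R (x, s) \<in> G" using sub xs(1) by (rule subspace_scale)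
      then have "\<bar>inverse a * s + r\<bar> \<le> c * norm (inverse a *\<^sub>R x + z)" using r by simp
      then have "\<bar>a\<bar> * \<bar>inverse a * s + r\<bar> \<le> \<bar>a\<bar> * (c * norm (inverse a *\<^sub>R x + z))"
        by (intro mult_left_mono) auto
      moreover have "a * (inverse a * s + r) = t"
        using False xs(3) by (simp add: distrib_left flip: mult.assoc)
      then have "\<bar>a\<bar> * \<bar>inverse a * s + r\<bar> = \<bar>t\<bar>" by (simp flip: abs_mult)
      moreover have "\<bar>a\<bar> * norm (inverse a *\<^sub>R x + z) = norm y"
        using False xs(2) by (simp flip: norm_scaleR add: scaleR_add_right)
      ultimately show ?thesis by (metis mult.left_commute)
    qed
  qed
  moreover have "G \<subseteq> G'"
    unfolding G'_def using span_zero by (metis (mono_tags, lifting) add.right_neutral mem_Collect_eq subsetI)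
  moreover have "(z, r) \<in> G'"
    unfolding G'_def using subspace_0[OF sub] span_base[of "(z, r)" "{(z, r)}"]
    by (metis (mono_tags, lifting) add.left_neutral insertI1 mem_Collect_eq)
  ultimately show ?thesis unfolding linear_graph_def by blast
qed

theorem hahn_banach:
  fixes f :: "'a::real_normed_vector \<Rightarrow> real"
  assumes W: "subspace W"
    and add: "\<And>x y. x \<in> W \<Longrightarrow> y \<in> W \<Longrightarrow> f (x + y) = f x + f y"
    and scale: "\<And>a x. x \<in> W \<Longrightarrow> f (a *\<^sub>R x) = a * f x"
    and bound: "\<And>x. x \<in> W \<Longrightarrow> \<bar>f x\<bar> \<le> c * norm x"
    and c: "0 \<le> c"
  obtains g :: "'a \<Rightarrow>\<^sub>L real" where "\<And>x. x \<in> W \<Longrightarrow> g x = f x" "norm g \<le> c"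
proof -
  define G0 where "G0 = (\<lambda>x. (x, f x)) ` W"
  have "subspace G0"
    unfolding subspace_def
  proof (intro conjI ballI allI)
    have "f 0 = 0" using scale[of 0 0] subspace_0[OF W] by simp
    then show "0 \<in> G0" using subspace_0[OF W] by (force simp: G0_def zero_prod_def)
  next
    fix p q assume "p \<in> G0" "q \<in> G0"
    then show "p + q \<in> G0" by (auto simp: G0_def add[symmetric] intro: subspace_add[OF W])
  next
    fix a :: real and p assume "p \<in> G0"
    then show "a *\<^sub>R p \<in> G0" by (auto simp: G0_def scale[symmetric] intro: subspace_scale[OF W])
  qed
  then have G0: "linear_graph c G0" using bound by (auto simp: linear_graph_def G0_def)
  define \<A> where "\<A> = {G. linear_graph c G \<and> G0 \<subseteq> G}"
  have "\<exists>M\<in>\<A>. \<forall>X\<in>\<A>. M \<subseteq> X \<longrightarrow> X = M"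
  proof (rule subset_Zorn_nonempty)
    show "\<A> \<noteq> {}" using G0 by (auto simp: \<A>_def)
    fix \<C> assume ne: "\<C> \<noteq> {}" and chain: "subset.chain \<A> \<C>"
    then have G: "linear_graph c G" "G0 \<subseteq> G" if "G \<in> \<C>" for G
      using that by (auto simp: \<A>_def subset_chain_def)
    have common: "\<exists>G\<in>\<C>. p \<in> G \<and> q \<in> G" if "p \<in> \<Union>\<C>" "q \<in> \<Union>\<C>" for p q
      using that chain unfolding subset_chain_def by blast
    have "subspace (\<Union>\<C>)"
      unfolding subspace_def
    proof (intro conjI ballI allI)
      show "0 \<in> \<Union>\<C>" using ne G(1) subspace_0 unfolding linear_graph_def by blast
    next
      fix p q assume "p \<in> \<Union>\<C>" "q \<in> \<Union>\<C>"
      then obtain G where "G \<in> \<C>" "p \<in> G" "q \<in> G" using common by blast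
      then show "p + q \<in> \<Union>\<C>" using G(1)[of G] subspace_add unfolding linear_graph_def by blast
    next
      fix a :: real and p assume "p \<in> \<Union>\<C>"
      then show "a *\<^sub>R p \<in> \<Union>\<C>" using G(1) subspace_scale unfolding linear_graph_def by blast
    qed
    moreover have "\<bar>r\<bar> \<le> c * norm x" if "(x, r) \<in> \<Union>\<C>" for x r
      using that G(1) unfolding linear_graph_def by blast
    moreover have "G0 \<subseteq> \<Union>\<C>" using ne G(2) by blast
    ultimately show "\<Union>\<C> \<in> \<A>" by (simp add: \<A>_def linear_graph_def)
  qed
  then obtain M where M: "linear_graph c M" "G0 \<subseteq> M"
    and max: "\<And>X. linear_graph c X \<Longrightarrow> M \<subseteq> X \<Longrightarrow> X = M" by (auto simp: \<A>_def)
  have total: "\<exists>r. (x, r) \<in> M" for x using linear_graph_extend[OF M(1) c, of x] max by metis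
  define g where "g x = (THE r. (x, r) \<in> M)" for x
  have gM: "(x, g x) \<in> M" for x
    unfolding g_def using total[of x] linear_graph_unique[OF M(1)] by (metis theI)
  have g: "r = g x" if "(x, r) \<in> M" for x r using linear_graph_unique[OF M(1) that gM] .
  have sub: "subspace M" and gb: "\<bar>g x\<bar> \<le> c * norm x" for x
    using M(1) gM by (auto simp: linear_graph_def)
  have "bounded_linear g"
  proof (rule bounded_linear_intro)
    show "g (x + y) = g x + g y" for x y
      using subspace_add[OF sub gM gM, of x y] by (auto dest: g)
    show "g (a *\<^sub>R x) = a *\<^sub>R g x" for a x
      using subspace_scale[OF sub gM, of a x] by (auto dest: g)
    show "norm (g x) \<le> norm x * c" for x using gb[of x] by (simp add: mult.commute)
  qed
  then have app: "blinfun_apply (Blinfun g) = g" by (rule bounded_linear_Blinfun_apply)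
  show thesis
  proof (rule that[of "Blinfun g"])
    show "Blinfun g x = f x" if "x \<in> W" for x
      using that M(2) g[of x "f x"] by (auto simp: app G0_def)
    show "norm (Blinfun g) \<le> c" using gb c by (intro norm_blinfun_bound) (auto simp: app)
  qed
qed

lemma ex_dual_norming:
  fixes v :: "'a::real_normed_vector"
  obtains g :: "'a \<Rightarrow>\<^sub>L real" where "norm g \<le> 1" "g v = norm v"
proof (cases "v = 0")
  case True
  then show thesis by (intro that[of 0]) auto
next
  case False
  define h where "h x = (THE a. x = a *\<^sub>R v) * norm v" for x
  have h: "h (a *\<^sub>R v) = a * norm v" for a using False by (simp add: h_def)
  obtain g :: "'a \<Rightarrow>\<^sub>L real" where g: "\<And>x. x \<in> span {v} \<Longrightarrow> g x = h x" "norm g \<le> 1"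
  proof (rule hahn_banach[of "span {v}" h 1])
    fix x y assume "x \<in> span {v}" "y \<in> span {v}"
    then show "h (x + y) = h x + h y"
      by (auto simp: span_singleton h algebra_simps simp flip: scaleR_add_left)
  next
    show "subspace (span {v})" by (rule subspace_span)
  qed (auto simp: span_singleton h abs_mult)
  then show thesis using g(1)[of v] h[of 1] by (intro that[of g]) (auto simp: span_base)
qed

lemma ex_dual_nonzero_off_subspace:
  fixes v :: "'a::real_normed_vector"
  assumes W: "subspace W" and v: "v \<notin> closure W"
  obtains g :: "'a \<Rightarrow>\<^sub>L real" where "\<And>x. x \<in> W \<Longrightarrow> g x = 0" "g v \<noteq> 0"
proof -
  obtain e where e: "0 < e" "\<And>x. x \<in> W \<Longrightarrow> e \<le> norm (v - x)"
    using v unfolding closure_approachable by (metis dist_norm norm_minus_commute not_le)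
  \<comment> \<open>the functional to be extended is the coefficient of \<open>v\<close>; its norm is at most \<open>1 / e\<close>\<close>
  define V where "V = {x + y |x y. x \<in> W \<and> y \<in> span {v}}"
  define h where "h z = (THE a. \<exists>x\<in>W. z = x + a *\<^sub>R v)" for z
  have uniq: "a = b" if "x \<in> W" "y \<in> W" "x + a *\<^sub>R v = y + b *\<^sub>R v" for x y a b
  proof (rule ccontr)
    assume "a \<noteq> b"
    have "(a - b) *\<^sub>R v = y - x" using that(3) by (simp add: algebra_simps)
    then have "v = inverse (a - b) *\<^sub>R (y - x)" using \<open>a \<noteq> b\<close> by (metis right_minus_eq scaleR_scaleR left_inverse scaleR_one)
    then have "v \<in> W" using that W by (simp add: subspace_diff subspace_scale)
    then show False using v closure_subset by blast
  qed
  have h: "h (x + a *\<^sub>R v) = a" if "x \<in> W" for x a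
    unfolding h_def using that uniq by (intro the_equality) blast+
  obtain g :: "'a \<Rightarrow>\<^sub>L real" where g: "\<And>x. x \<in> V \<Longrightarrow> g x = h x" "norm g \<le> 1 / e"
  proof (rule hahn_banach[of V h "1 / e"])
    show "subspace V" unfolding V_def by (intro subspace_sums W subspace_span)
    show "0 \<le> 1 / e" using e by simp
  next
    fix x y assume "x \<in> V" "y \<in> V"
    then obtain p a q b where *: "x = p + a *\<^sub>R v" "p \<in> W" "y = q + b *\<^sub>R v" "q \<in> W"
      by (auto simp: V_def span_singleton)
    have "x + y = (p + q) + (a + b) *\<^sub>R v" using * by (simp add: algebra_simps)
    then have "h (x + y) = a + b" by (metis h subspace_add[OF W] *(2,4))
    then show "h (x + y) = h x + h y" using * h by simp
  next
    fix c x assume "x \<in> V"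
    then obtain p a where *: "x = p + a *\<^sub>R v" "p \<in> W" by (auto simp: V_def span_singleton)
    have "c *\<^sub>R x = c *\<^sub>R p + (c * a) *\<^sub>R v" using * by (simp add: algebra_simps)
    then have "h (c *\<^sub>R x) = c * a" by (metis h subspace_scale[OF W] *(2))
    then show "h (c *\<^sub>R x) = c * h x" using * h by simp
  next
    fix x assume "x \<in> V"
    then obtain p a where *: "x = p + a *\<^sub>R v" "p \<in> W" by (auto simp: V_def span_singleton)
    have "\<bar>a\<bar> * e \<le> norm x"
    proof (cases "a = 0")
      case False
      have "- inverse a *\<^sub>R p \<in> W" using *(2) W by (rule subspace_scale[rotated])
      then have "e \<le> norm (v - - inverse a *\<^sub>R p)" by (rule e(2))
      then have "\<bar>a\<bar> * e \<le> \<bar>a\<bar> * norm (v - - inverse a *\<^sub>R p)" by (intro mult_left_mono) auto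
      also have "\<dots> = norm (a *\<^sub>R (v - - inverse a *\<^sub>R p))" by simp
      also have "a *\<^sub>R (v - - inverse a *\<^sub>R p) = x" using False * by (simp add: algebra_simps)
      finally show ?thesis .
    qed simp
    then show "\<bar>h x\<bar> \<le> 1 / e * norm x" using * h e by (simp add: field_simps)
  qed blast
  show thesis
  proof (rule that[of g])
    show "g x = 0" if "x \<in> W" for x
    proof -
      have "x \<in> V" unfolding V_def using that span_zero by force
      then show ?thesis using g(1)[of x] h[OF that, of 0] by simp
    qed
    have "v \<in> V" unfolding V_def using subspace_0[OF W] span_base[of v "{v}"] by force
    then show "g v \<noteq> 0" using g(1)[of v] h[OF subspace_0[OF W], of 1] by simp
  qed
qed

section \<open>Finitely many functionals, and separability of the dual\<close>

text \<open>Induction on \<open>F\<close>: a vector \<open>w\<close> in the kernel of the other functionals with \<open>\<phi> w \<noteq> 0\<close> determines the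
multiple of \<open>\<phi>\<close> to be subtracted from \<open>\<psi>\<close>.\<close>

lemma in_span_of_common_kernel:
  fixes \<psi> :: "'a::real_normed_vector \<Rightarrow>\<^sub>L real"
  assumes "finite F" "\<And>v. (\<forall>\<phi>\<in>F. blinfun_apply \<phi> v = 0) \<Longrightarrow> \<psi> v = 0"
  shows "\<psi> \<in> span F"
  using assms
proof (induction F arbitrary: \<psi> rule: finite_induct)
  case empty
  then have "\<psi> = 0" by (intro blinfun_eqI) simp
  then show ?case by (simp add: span_zero)
next
  case (insert \<phi> F)
  show ?case
  proof (cases "\<exists>w. (\<forall>\<xi>\<in>F. blinfun_apply \<xi> w = 0) \<and> \<phi> w \<noteq> 0")
    case False
    then have "\<psi> v = 0" if "\<forall>\<xi>\<in>F. blinfun_apply \<xi> v = 0" for v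
      using that insert.prems[of v] by blast
    then have "\<psi> \<in> span F" by (rule insert.IH)
    then show ?thesis using span_mono[of F "insert \<phi> F"] by blast
  next
    case True
    then obtain w where w: "\<And>\<xi>. \<xi> \<in> F \<Longrightarrow> blinfun_apply \<xi> w = 0" "\<phi> w \<noteq> 0" by blast
    define a where "a = \<psi> w / \<phi> w"
    have "\<psi> - a *\<^sub>R \<phi> \<in> span F"
    proof (rule insert.IH)
      fix v assume v: "\<forall>\<xi>\<in>F. blinfun_apply \<xi> v = 0"
      define u where "u = v - (\<phi> v / \<phi> w) *\<^sub>R w"
      have "\<psi> u = 0" using v w by (intro insert.prems) (auto simp: u_def blinfun.diff_right blinfun.scaleR_right)
      then show "blinfun_apply (\<psi> - a *\<^sub>R \<phi>) v = 0"
        by (simp add: u_def a_def blinfun.diff_right blinfun.diff_left blinfun.scaleR_right blinfun.scaleR_left)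
    qed
    then have "\<psi> - a *\<^sub>R \<phi> \<in> span (insert \<phi> F)" using span_mono[of F "insert \<phi> F"] by blast
    moreover have "a *\<^sub>R \<phi> \<in> span (insert \<phi> F)" by (intro span_scale span_base) simp
    ultimately show ?thesis using span_add[of "\<psi> - a *\<^sub>R \<phi>" "insert \<phi> F" "a *\<^sub>R \<phi>"] by simp
  qed
qed

text \<open>Helly's argument. If \<open>\<psi>\<close> were small on the common kernel, an extension \<open>g\<close> of its restriction would be small
on the whole space, and \<open>\<psi> - g\<close>, which vanishes on the kernel, would be an element of the span close to \<open>\<psi>\<close>.\<close>

lemma ex_common_kernel_large:
  fixes \<psi> :: "'a::real_normed_vector \<Rightarrow>\<^sub>L real"
  assumes "finite F" and far: "\<And>\<xi>. \<xi> \<in> span F \<Longrightarrow> \<delta> < norm (\<psi> - \<xi>)" and "0 \<le> \<delta>"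
  obtains v where "norm v \<le> 1" "\<And>\<phi>. \<phi> \<in> F \<Longrightarrow> blinfun_apply \<phi> v = 0" "\<delta> < \<bar>\<psi> v\<bar>"
proof -
  define W where "W = {v. \<forall>\<phi>\<in>F. blinfun_apply \<phi> v = 0}"
  have W: "subspace W"
    by (auto simp: W_def subspace_def blinfun.add_right blinfun.scaleR_right)
  have "\<exists>v\<in>W. norm v \<le> 1 \<and> \<delta> < \<bar>\<psi> v\<bar>"
  proof (rule ccontr)
    assume "\<not> ?thesis"
    then have small: "\<bar>\<psi> v\<bar> \<le> \<delta>" if "v \<in> W" "norm v \<le> 1" for v using that by force
    have "\<bar>\<psi> v\<bar> \<le> \<delta> * norm v" if "v \<in> W" for v
    proof (cases "v = 0")
      case False
      have "inverse (norm v) *\<^sub>R v \<in> W" using W that by (rule subspace_scale)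
      then have "\<bar>\<psi> (inverse (norm v) *\<^sub>R v)\<bar> \<le> \<delta>" using False by (intro small) auto
      then show ?thesis using False by (simp add: blinfun.scaleR_right abs_mult field_simps)
    qed simp
    then obtain g :: "'a \<Rightarrow>\<^sub>L real" where g: "\<And>v. v \<in> W \<Longrightarrow> g v = \<psi> v" "norm g \<le> \<delta>"
      using \<open>0 \<le> \<delta>\<close>
      by - (rule hahn_banach[OF W, of "blinfun_apply \<psi>" \<delta>],
        auto simp: blinfun.add_right blinfun.scaleR_right)
    have "\<psi> - g \<in> span F"
      using g(1) by (intro in_span_of_common_kernel assms(1)) (auto simp: W_def blinfun.diff_left)
    from far[OF this] g(2) show False by simp
  qed
  then show thesis using that by (auto simp: W_def)
qed

lemma finite_codimension_common_kernel:
  fixes F :: "('a::real_normed_vector \<Rightarrow>\<^sub>L real) set"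
  assumes "finite F"
  shows "\<exists>B. finite B \<and> (\<forall>u. \<exists>x\<in>span B. \<forall>\<phi>\<in>F. blinfun_apply \<phi> (u - x) = 0)"
  using assms
proof (induction F rule: finite_induct)
  case empty
  then show ?case by auto
next
  case (insert \<phi> F)
  then obtain B where B: "finite B" "\<And>u. \<exists>x\<in>span B. \<forall>\<xi>\<in>F. blinfun_apply \<xi> (u - x) = 0" by blast
  show ?case
  proof (cases "\<exists>w. (\<forall>\<xi>\<in>F. blinfun_apply \<xi> w = 0) \<and> \<phi> w \<noteq> 0")
    case False
    then show ?thesis using B by (intro exI[of _ B]) (metis insert_iff)
  next
    case True
    then obtain w where w: "\<And>\<xi>. \<xi> \<in> F \<Longrightarrow> blinfun_apply \<xi> w = 0" "\<phi> w \<noteq> 0" by blast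
    have "\<exists>x\<in>span (insert w B). \<forall>\<xi>\<in>insert \<phi> F. blinfun_apply \<xi> (u - x) = 0" for u
    proof -
      obtain x where x: "x \<in> span B" "\<And>\<xi>. \<xi> \<in> F \<Longrightarrow> blinfun_apply \<xi> (u - x) = 0" using B(2) by blast
      define y where "y = x + (\<phi> (u - x) / \<phi> w) *\<^sub>R w"
      have "y \<in> span (insert w B)"
        unfolding y_def using span_mono[of B "insert w B"] x(1)
        by (intro span_add span_scale) (auto intro: span_base)
      moreover have "blinfun_apply \<xi> (u - y) = 0" if "\<xi> \<in> insert \<phi> F" for \<xi>
      proof -
        have "u - y = (u - x) - (\<phi> (u - x) / \<phi> w) *\<^sub>R w" by (simp add: y_def)
        then have "blinfun_apply \<xi> (u - y) = \<xi> (u - x) - \<phi> (u - x) / \<phi> w * \<xi> w"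
          by (simp only: blinfun.diff_right blinfun.scaleR_right real_scaleR_def)
        then show ?thesis using that w x(2) by auto
      qed
      ultimately show ?thesis by blast
    qed
    then show ?thesis using B(1) by (intro exI[of _ "insert w B"]) auto
  qed
qed

lemma countable_dense_in_span:
  fixes S :: "'a::real_normed_vector set"
  assumes "countable S"
  obtains C where "countable C" "span S \<subseteq> closure C"
proof -
  define C where "C = (\<lambda>xs. \<Sum>(q, s)\<leftarrow>xs. q *\<^sub>R s) ` lists (\<rat> \<times> S)"
  have "countable C"
    unfolding C_def using assms by (intro countable_image countable_lists countable_SIGMA countable_rat)
  have add: "x + y \<in> C" if "x \<in> C" "y \<in> C" for x y
  proof -
    obtain xs ys where "xs \<in> lists (\<rat> \<times> S)" "x = (\<Sum>(q, s)\<leftarrow>xs. q *\<^sub>R s)"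
      "ys \<in> lists (\<rat> \<times> S)" "y = (\<Sum>(q, s)\<leftarrow>ys. q *\<^sub>R s)" using \<open>x \<in> C\<close> \<open>y \<in> C\<close> by (auto simp: C_def)
    then show ?thesis unfolding C_def by (intro image_eqI[of _ _ "xs @ ys"]) auto
  qed
  have rational: "q *\<^sub>R s \<in> C" if "q \<in> \<rat>" "s \<in> S" for q s
    unfolding C_def using that by (intro image_eqI[of _ _ "[(q, s)]"]) auto
  have scale: "r *\<^sub>R s \<in> closure C" if s: "s \<in> S" for r s
  proof -
    obtain q where q: "\<And>n::nat. q n \<in> \<rat>" "q \<longlonglongrightarrow> r"
      using Rats_closure_real closure_sequential[of r \<rat>] by auto
    then have "(\<lambda>n. q n *\<^sub>R s) \<longlonglongrightarrow> r *\<^sub>R s" by (intro tendsto_intros)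
    then show ?thesis
      unfolding closure_sequential using q(1) s rational by (intro exI[of _ "\<lambda>n. q n *\<^sub>R s"]) auto
  qed
  have "x \<in> closure C" if "x \<in> span S" for x
    using that
  proof (induction rule: span_induct_alt)
    case base
    have "0 \<in> C" unfolding C_def by (intro image_eqI[of _ _ "[]"]) auto
    then show ?case using closure_subset by blast
  next
    case (step c x y)
    obtain f where f: "\<forall>n. f n \<in> C" "f \<longlonglongrightarrow> c *\<^sub>R x"
      using scale[OF step(1), of c] unfolding closure_sequential by (elim exE conjE)
    obtain g where g: "\<forall>n. g n \<in> C" "g \<longlonglongrightarrow> y"
      using step(2) unfolding closure_sequential by (elim exE conjE)
    from f g show ?case unfolding closure_sequential
      using add by (intro exI[of _ "\<lambda>n. f n + g n"]) (auto intro: tendsto_add)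
  qed
  then show thesis using that[OF \<open>countable C\<close>] by blast
qed

text \<open>For each functional \<open>\<phi>\<close> of a dense set choose a vector of the unit ball where \<open>\<phi>\<close> reaches half its norm.
A functional that vanishes at all these vectors cannot be approximated from the dense set unless it
is zero, so the vectors span a dense subspace.\<close>

lemma separable_if_separable_dual:
  fixes D :: "('a::real_normed_vector \<Rightarrow>\<^sub>L real) set"
  assumes D: "countable D" "closure D = UNIV"
  shows "separable_space (euclidean :: 'a topology)"
proof -
  have "\<exists>v. norm v \<le> 1 \<and> norm \<phi> \<le> 2 * \<bar>blinfun_apply \<phi> v\<bar>" for \<phi> :: "'a \<Rightarrow>\<^sub>L real"
  proof (rule ccontr)
    assume "\<not> ?thesis"
    then have *: "\<And>v. norm v \<le> 1 \<Longrightarrow> 2 * \<bar>\<phi> v\<bar> < norm \<phi>" by force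
    have "\<bar>\<phi> v\<bar> \<le> norm \<phi> / 2 * norm v" for v
    proof (cases "v = 0")
      case False
      then have "2 * \<bar>\<phi> (inverse (norm v) *\<^sub>R v)\<bar> < norm \<phi>" by (intro *) simp
      then show ?thesis using False by (simp add: blinfun.scaleR_right abs_mult field_simps)
    qed simp
    then have "norm \<phi> \<le> norm \<phi> / 2" by (intro norm_blinfun_bound) simp_all
    moreover have "0 < norm \<phi>" using *[of 0] by simp
    ultimately show False by simp
  qed
  then have "\<exists>v. \<forall>\<phi> :: 'a \<Rightarrow>\<^sub>L real. norm (v \<phi>) \<le> 1 \<and> norm \<phi> \<le> 2 * \<bar>blinfun_apply \<phi> (v \<phi>)\<bar>"
    by (intro choice allI)
  then obtain v where v: "\<And>\<phi> :: 'a \<Rightarrow>\<^sub>L real. norm (v \<phi>) \<le> 1 \<and> norm \<phi> \<le> 2 * \<bar>blinfun_apply \<phi> (v \<phi>)\<bar>"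
    by blast
  obtain C where C: "countable C" "span (v ` D) \<subseteq> closure C"
    by (rule countable_dense_in_span[OF countable_image[OF D(1), of v]])
  have "x \<in> closure (span (v ` D))" for x
  proof (rule ccontr)
    assume "x \<notin> closure (span (v ` D))"
    then obtain g :: "'a \<Rightarrow>\<^sub>L real" where g: "\<And>y. y \<in> span (v ` D) \<Longrightarrow> g y = 0" "g x \<noteq> 0"
      by (rule ex_dual_nonzero_off_subspace[OF subspace_span]) blast
    then have "0 < norm g" by auto
    obtain \<phi> where \<phi>: "\<phi> \<in> D" "dist \<phi> g < norm g / 4"
      using D(2) \<open>0 < norm g\<close> closure_approachable[of g D] by (metis UNIV_I divide_pos_pos zero_less_numeral)
    have "\<bar>blinfun_apply (\<phi> - g) (v \<phi>)\<bar> \<le> norm (\<phi> - g) * norm (v \<phi>)"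
      using norm_blinfun[of "\<phi> - g" "v \<phi>"] by simp
    also have "\<dots> \<le> norm (\<phi> - g) * 1" using v by (intro mult_left_mono) auto
    finally have "\<bar>\<phi> (v \<phi>)\<bar> \<le> norm (\<phi> - g)"
      using g(1)[of "v \<phi>"] \<phi>(1) by (simp add: blinfun.diff_left span_base)
    then have "norm \<phi> < norm g / 2" using v[of \<phi>] \<phi>(2) by (simp add: dist_norm)
    moreover have "norm g \<le> norm \<phi> + norm (\<phi> - g)" by (metis norm_triangle_sub norm_minus_commute)
    ultimately show False using \<phi>(2) \<open>0 < norm g\<close> by (simp add: dist_norm)
  qed
  then have "closure C = UNIV" using closure_mono[OF C(2)] by auto
  then show ?thesis using C(1) by (auto simp: separable_space_def)
qed

section \<open>The enveloping semigroup as a compact space\<close>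

lemma dual_ball_iff: "\<phi> \<in> dual_ball \<longleftrightarrow> norm \<phi> \<le> 1"
  by (simp add: dual_ball_def)

lemma topspace_dual_ball_topology: "topspace dual_ball_topology = dual_ball"
  by (simp add: dual_ball_topology_def strong_operator_topology_topspace)

lemma continuous_map_dual_ball_eval: "continuous_map dual_ball_topology euclidean (\<lambda>\<phi>. blinfun_apply \<phi> v)"
  unfolding dual_ball_topology_def
  by (rule continuous_map_from_subtopology[OF strong_operator_topology_continuous_evaluation])

text \<open>The dual ball is the image of a closed set of functions in the product of the intervals
\<open>[-\<parallel>x\<parallel>, \<parallel>x\<parallel>]\<close>.\<close>

theorem banach_alaoglu: "compact_space (dual_ball_topology :: ('a::real_normed_vector \<Rightarrow>\<^sub>L real) topology)"
proof -
  define S where "S = {f :: 'a \<Rightarrow> real. (\<forall>x y. f (x + y) = f x + f y) \<and> (\<forall>a x. f (a *\<^sub>R x) = a * f x) \<and>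
    (\<forall>x. f x \<in> {- norm x..norm x})}"
  have "compactin (product_topology (\<lambda>_. euclidean) UNIV) (Pi\<^sub>E UNIV (\<lambda>x :: 'a. {- norm x..norm x}))"
    by (simp add: compactin_PiE)
  then have box: "compact (Pi\<^sub>E UNIV (\<lambda>x :: 'a. {- norm x..norm x}))"
    by (simp add: euclidean_product_topology)
  have "closed (\<Inter>x y. {f :: 'a \<Rightarrow> real. f (x + y) = f x + f y})"
    "closed (\<Inter>a x. {f :: 'a \<Rightarrow> real. f (a *\<^sub>R x) = a * f x})"
    by (intro closed_INT ballI closed_Collect_eq continuous_intros continuous_on_product_coordinates)+
  then have "compact ((Pi\<^sub>E UNIV (\<lambda>x :: 'a. {- norm x..norm x})) \<inter>
      ((\<Inter>x y. {f :: 'a \<Rightarrow> real. f (x + y) = f x + f y}) \<inter> (\<Inter>a x. {f :: 'a \<Rightarrow> real. f (a *\<^sub>R x) = a * f x})))"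
    by (intro compact_Int_closed[OF box] closed_Int)
  also have "\<dots> = S" by (auto simp: S_def PiE_iff)
  finally have S: "compact S" .
  have app: "blinfun_apply (Blinfun f) = f" if "f \<in> S" for f
  proof (rule bounded_linear_Blinfun_apply[OF bounded_linear_intro])
    show "norm (f x) \<le> norm x * 1" for x
      using that by (auto simp: S_def abs_le_iff minus_le_iff)
  qed (use that in \<open>auto simp: S_def\<close>)
  have "continuous_map (top_of_set S) euclidean (\<lambda>f. blinfun_apply (Blinfun f) x)" for x
  proof -
    have "continuous_on S (\<lambda>f. blinfun_apply (Blinfun f) x)"
      by (rule continuous_on_eq[OF continuous_on_subset[OF continuous_on_product_coordinates]])
        (auto simp: app)
    then show ?thesis by simp
  qed
  then have "continuous_map (top_of_set S) strong_operator_topology Blinfun"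
    unfolding continuous_on_strong_operator_topo_iff_coordinatewise by blast
  moreover have "compactin (top_of_set S) S"
    using S by (simp add: compactin_subtopology)
  ultimately have "compactin strong_operator_topology (Blinfun ` S)" by (rule image_compactin[rotated])
  moreover have "Blinfun ` S = (dual_ball :: ('a \<Rightarrow>\<^sub>L real) set)"
  proof
    show "Blinfun ` S \<subseteq> dual_ball"
    proof clarify
      fix f assume f: "f \<in> S"
      have "\<bar>f x\<bar> \<le> 1 * norm x" for x using f by (auto simp: S_def abs_le_iff minus_le_iff)
      then show "Blinfun f \<in> dual_ball"
        unfolding dual_ball_iff by (intro norm_blinfun_bound) (auto simp: app[OF f])
    qed
    show "dual_ball \<subseteq> Blinfun ` S"
    proof
      fix \<phi> :: "'a \<Rightarrow>\<^sub>L real" assume "\<phi> \<in> dual_ball"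
      then have "\<bar>\<phi> x\<bar> \<le> norm x" for x
        using norm_blinfun[of \<phi> x] mult_right_mono[of "norm \<phi>" 1 "norm x"] by (simp add: dual_ball_iff)
      then have "blinfun_apply \<phi> \<in> S"
        by (auto simp: S_def blinfun.add_right blinfun.scaleR_right abs_le_iff minus_le_iff)
      then show "\<phi> \<in> Blinfun ` S" by (metis blinfun_apply_inverse image_eqI)
    qed
  qed
  ultimately show ?thesis unfolding dual_ball_topology_def by (simp add: compact_space_subtopology)
qed

abbreviation adjoint_maps :: "(('a::real_normed_vector \<Rightarrow>\<^sub>L real) \<Rightarrow> ('a \<Rightarrow>\<^sub>L real)) set" where
  "adjoint_maps \<equiv> (\<lambda>T. restrict (adjoint_op T) dual_ball) ` contractions"

lemma adjoint_maps_subset_topspace: "adjoint_maps \<subseteq> topspace dual_ball_maps_topology"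
  using restrict_adjoint_op_in_topspace by blast

lemma adjoint_maps_subset: "adjoint_maps \<subseteq> enveloping_semigroup"
  unfolding enveloping_semigroup_def by (rule closure_of_subset[OF adjoint_maps_subset_topspace])

lemma topspace_enveloping_topology:
  "topspace (enveloping_topology TYPE('a::real_normed_vector)) = enveloping_semigroup"
  unfolding enveloping_topology_def enveloping_semigroup_def
  by (simp add: closure_of_subset_topspace Int_absorb1)

lemma compact_enveloping: "compact_space (enveloping_topology TYPE('a::real_normed_vector))"
proof -
  have "compact_space (dual_ball_maps_topology :: (('a \<Rightarrow>\<^sub>L real) \<Rightarrow> ('a \<Rightarrow>\<^sub>L real)) topology)"
    unfolding dual_ball_maps_topology_def by (simp add: compact_space_product_topology banach_alaoglu)
  then show ?thesis
    unfolding enveloping_topology_def enveloping_semigroup_def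
    by (intro compact_space_subtopology closedin_compact_space closedin_closure_of)
qed

lemma continuous_map_maps_eval:
  assumes "\<phi> \<in> dual_ball"
  shows "continuous_map dual_ball_maps_topology euclidean (\<lambda>p. blinfun_apply (p \<phi>) v)"
  using continuous_map_compose[OF continuous_map_product_projection[OF assms] continuous_map_dual_ball_eval]
  unfolding dual_ball_maps_topology_def by (simp add: o_def)

lemma continuous_map_enveloping_eval:
  assumes "\<phi> \<in> dual_ball"
  shows "continuous_map (enveloping_topology TYPE('a::real_normed_vector)) euclidean
    (\<lambda>p. blinfun_apply (p \<phi>) v)"
  unfolding enveloping_topology_def
  by (rule continuous_map_from_subtopology[OF continuous_map_maps_eval[OF assms]])

lemma enveloping_PiE:
  assumes "p \<in> enveloping_semigroup"
  shows "p \<in> Pi\<^sub>E dual_ball (\<lambda>_. dual_ball)"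
proof -
  have "p \<in> topspace dual_ball_maps_topology"
    using assms unfolding enveloping_semigroup_def by (rule subsetD[OF closure_of_subset_topspace])
  then show ?thesis by (simp add: dual_ball_maps_topology_def topspace_dual_ball_topology)
qed

lemma norm_adjoint_op_le: "T \<in> contractions \<Longrightarrow> norm (adjoint_op T \<phi>) \<le> norm \<phi>"
  using norm_blinfun_compose[of \<phi> T] mult_left_mono[of "norm T" 1 "norm \<phi>"]
  by (simp add: adjoint_op_def contractions_def)

text \<open>The inequality holds for adjoints of contractions, and it is a closed condition on \<open>p\<close> for the
pointwise weak-star topology.\<close>

lemma enveloping_nonexpansive:
  fixes v :: "'a::real_normed_vector"
  assumes p: "p \<in> enveloping_semigroup" and \<phi>: "\<phi> \<in> dual_ball" and \<psi>: "\<psi> \<in> dual_ball"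
  shows "\<bar>blinfun_apply (p \<phi>) v - blinfun_apply (p \<psi>) v\<bar> \<le> norm (\<phi> - \<psi>) * norm v"
proof -
  let ?X = "dual_ball_maps_topology :: (('a \<Rightarrow>\<^sub>L real) \<Rightarrow> ('a \<Rightarrow>\<^sub>L real)) topology"
  let ?f = "\<lambda>p. \<bar>blinfun_apply (p \<phi>) v - blinfun_apply (p \<psi>) v\<bar>"
  have "continuous_map ?X euclideanreal ?f"
    by (intro continuous_map_real_abs continuous_map_diff continuous_map_maps_eval \<phi> \<psi>)
  then have "closedin ?X {p \<in> topspace ?X. ?f p \<in> {..norm (\<phi> - \<psi>) * norm v}}"
    by (rule closedin_continuous_map_preimage) (simp flip: closed_closedin)
  moreover have "adjoint_maps \<subseteq> {p \<in> topspace ?X. ?f p \<in> {..norm (\<phi> - \<psi>) * norm v}}"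
  proof
    fix q :: "('a \<Rightarrow>\<^sub>L real) \<Rightarrow> ('a \<Rightarrow>\<^sub>L real)" assume "q \<in> adjoint_maps"
    then obtain T where T: "T \<in> contractions" and q: "q = restrict (adjoint_op T) dual_ball" by blast
    have "\<bar>blinfun_apply (adjoint_op T (\<phi> - \<psi>)) v\<bar> \<le> norm (adjoint_op T (\<phi> - \<psi>)) * norm v"
      using norm_blinfun[of "adjoint_op T (\<phi> - \<psi>)" v] by simp
    also have "\<dots> \<le> norm (\<phi> - \<psi>) * norm v"
      by (intro mult_right_mono norm_adjoint_op_le T) auto
    finally have "?f q \<le> norm (\<phi> - \<psi>) * norm v"
      using \<phi> \<psi> by (simp add: q adjoint_op_def blinfun.diff_left)
    then show "q \<in> {p \<in> topspace ?X. ?f p \<in> {..norm (\<phi> - \<psi>) * norm v}}"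
      using restrict_adjoint_op_in_topspace[OF T] q by simp
  qed
  ultimately have "enveloping_semigroup \<subseteq> {p \<in> topspace ?X. ?f p \<in> {..norm (\<phi> - \<psi>) * norm v}}"
    unfolding enveloping_semigroup_def by (rule closure_of_minimal[rotated])
  then show ?thesis using p by auto
qed

definition rank_one :: "('a::real_normed_vector \<Rightarrow>\<^sub>L real) \<Rightarrow> 'a \<Rightarrow> ('a \<Rightarrow>\<^sub>L 'a)" where
  "rank_one f v = Blinfun (\<lambda>x. f x *\<^sub>R v)"

lemma rank_one_apply: "blinfun_apply (rank_one f v) x = f x *\<^sub>R v"
  unfolding rank_one_def
  by (subst bounded_linear_Blinfun_apply)
    (auto intro: bounded_linear_scaleR_left[THEN bounded_linear_compose] blinfun.bounded_linear_right)

lemma rank_one_contraction: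
  assumes "norm f \<le> 1" "norm v \<le> 1"
  shows "rank_one f v \<in> contractions"
proof -
  have "norm (rank_one f v) \<le> 1"
  proof (rule norm_blinfun_bound)
    fix x
    have "norm (f x) \<le> norm f * norm x" by (rule norm_blinfun)
    also have "\<dots> \<le> 1 * norm x" using assms by (intro mult_right_mono) auto
    finally have "norm (f x) * norm v \<le> norm x * 1" using assms by (intro mult_mono) auto
    then show "norm (blinfun_apply (rank_one f v) x) \<le> 1 * norm x" by (simp add: rank_one_apply)
  qed simp
  then show ?thesis by (simp add: contractions_def)
qed

lemma adjoint_rank_one_apply: "blinfun_apply (adjoint_op (rank_one f v) \<phi>) x = f x * \<phi> v"
  by (simp add: adjoint_op_def rank_one_apply blinfun.scaleR_right)

section \<open>Metrizability and separability of the dual\<close>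

text \<open>A basic neighbourhood of the zero map restricts the values at finitely many functionals only, so it
contains every \<open>p\<close> that vanishes at them. The set \<open>D\<close> collects these functionals over a countable base;
a functional far from its span would be detected by adjoints of rank one operators.\<close>

lemma dual_separable_if_first_countable:
  assumes fc: "first_countable (enveloping_topology TYPE('a::banach))"
  obtains D :: "('a::banach \<Rightarrow>\<^sub>L real) set" where "countable D" "closure D = UNIV"
proof (cases "\<exists>u :: 'a. u \<noteq> 0")
  case False
  have "\<phi> \<in> {0}" for \<phi> :: "'a \<Rightarrow>\<^sub>L real"
  proof -
    have "blinfun_apply \<phi> x = 0" for x using False by (metis blinfun.zero_right)
    then have "\<phi> = 0" by (intro blinfun_eqI) simp
    then show ?thesis by simp
  qed
  then have "(UNIV :: ('a \<Rightarrow>\<^sub>L real) set) \<subseteq> {0}" by (rule subsetI)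
  then have "countable (UNIV :: ('a \<Rightarrow>\<^sub>L real) set)" by (rule countable_subset) simp
  then show thesis by (intro that[of UNIV]) simp_all
next
  case True
  then obtain u :: 'a where "u \<noteq> 0" by blast
  obtain f :: "'a \<Rightarrow>\<^sub>L real" where f: "norm f \<le> 1" "f u = norm u" by (rule ex_dual_norming)
  let ?E = "enveloping_topology TYPE('a)"
  define z :: "('a \<Rightarrow>\<^sub>L real) \<Rightarrow> ('a \<Rightarrow>\<^sub>L real)" where "z = restrict (adjoint_op 0) dual_ball"
  have z_apply: "z \<phi> = 0" if "\<phi> \<in> dual_ball" for \<phi>
    using that by (simp add: z_def adjoint_op_def)
  have "z \<in> adjoint_maps" unfolding z_def by (intro imageI) (simp add: contractions_def)
  then have z: "z \<in> topspace ?E" using adjoint_maps_subset topspace_enveloping_topology by blast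
  obtain \<B> where \<B>: "countable \<B>" "\<And>U. U \<in> \<B> \<Longrightarrow> openin ?E U"
    "\<And>U. openin ?E U \<Longrightarrow> z \<in> U \<Longrightarrow> \<exists>V\<in>\<B>. z \<in> V \<and> V \<subseteq> U"
    using fc z unfolding first_countable_def by meson
  have "\<exists>F. finite F \<and> F \<subseteq> dual_ball \<and>
      (\<forall>p\<in>enveloping_semigroup. (\<forall>\<phi>\<in>F. p \<phi> = 0) \<longrightarrow> p \<in> U)" if U: "U \<in> \<B>" "z \<in> U" for U
  proof -
    obtain O' where O': "openin dual_ball_maps_topology O'" "U = O' \<inter> enveloping_semigroup"
      using \<B>(2)[OF U(1)] unfolding enveloping_topology_def openin_subtopology by blast
    then obtain V where V: "finite {\<phi> \<in> dual_ball. V \<phi> \<noteq> topspace dual_ball_topology}"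
      "z \<in> Pi\<^sub>E dual_ball V" "Pi\<^sub>E dual_ball V \<subseteq> O'"
      using U(2) unfolding dual_ball_maps_topology_def openin_product_topology_alt by blast
    define F where "F = {\<phi> \<in> dual_ball. V \<phi> \<noteq> topspace dual_ball_topology}"
    have "p \<in> U" if p: "p \<in> enveloping_semigroup" and zero: "\<forall>\<phi>\<in>F. p \<phi> = 0" for p
    proof -
      have "p \<phi> \<in> V \<phi>" if \<phi>: "\<phi> \<in> dual_ball" for \<phi>
      proof (cases "\<phi> \<in> F")
        case True
        then show ?thesis using zero V(2) z_apply[OF \<phi>] \<phi> by (auto simp: PiE_iff)
      next
        case False
        then show ?thesis using enveloping_PiE[OF p] \<phi>
          by (auto simp: F_def PiE_iff topspace_dual_ball_topology)
      qed
      then have "p \<in> Pi\<^sub>E dual_ball V" using enveloping_PiE[OF p] by (simp add: PiE_iff)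
      then show ?thesis using V(3) O'(2) p by blast
    qed
    then show ?thesis using V(1) by (intro exI[of _ F]) (auto simp: F_def)
  qed
  then have "\<exists>F. \<forall>U\<in>{U \<in> \<B>. z \<in> U}. finite (F U) \<and> F U \<subseteq> dual_ball \<and>
      (\<forall>p\<in>enveloping_semigroup. (\<forall>\<phi>\<in>F U. p \<phi> = 0) \<longrightarrow> p \<in> U)"
    by (intro bchoice) blast
  then obtain F where F: "\<And>U. U \<in> \<B> \<Longrightarrow> z \<in> U \<Longrightarrow> finite (F U)"
    "\<And>U p. U \<in> \<B> \<Longrightarrow> z \<in> U \<Longrightarrow> p \<in> enveloping_semigroup \<Longrightarrow> \<forall>\<phi>\<in>F U. p \<phi> = 0 \<Longrightarrow> p \<in> U"
    "\<And>U. U \<in> \<B> \<Longrightarrow> z \<in> U \<Longrightarrow> F U \<subseteq> dual_ball"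
    by blast
  define D where "D = (\<Union>U\<in>{U \<in> \<B>. z \<in> U}. F U)"
  have "countable D"
    unfolding D_def
  proof (rule countable_UN)
    show "countable {U \<in> \<B>. z \<in> U}" by (rule countable_subset[OF _ \<B>(1)]) auto
  qed (auto intro: countable_finite F(1))
  have dense_ball: "\<psi> \<in> closure (span D)" if \<psi>: "\<psi> \<in> dual_ball" for \<psi>
  proof (rule ccontr)
    assume "\<psi> \<notin> closure (span D)"
    then obtain e where e: "0 < e" "\<And>\<xi>. \<xi> \<in> span D \<Longrightarrow> e \<le> norm (\<psi> - \<xi>)"
      unfolding closure_approachable by (metis dist_norm norm_minus_commute not_le)
    define O' where "O' = {p \<in> topspace ?E. blinfun_apply (p \<psi>) u \<in> {- (norm u * (e/2))<..<norm u * (e/2)}}"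
    have "openin ?E O'"
      unfolding O'_def
      by (rule openin_continuous_map_preimage[OF continuous_map_enveloping_eval[OF \<psi>]]) auto
    moreover have "z \<in> O'" using z z_apply[OF \<psi>] \<open>u \<noteq> 0\<close> e by (simp add: O'_def)
    ultimately obtain U where U: "U \<in> \<B>" "z \<in> U" "U \<subseteq> O'" using \<B>(3) by blast
    have "e / 2 < norm (\<psi> - \<xi>)" if "\<xi> \<in> span (F U)" for \<xi>
    proof -
      have "F U \<subseteq> D" using U by (auto simp: D_def)
      then have "\<xi> \<in> span D" using that span_mono by blast
      then show ?thesis using e by fastforce
    qed
    then obtain v where v: "norm v \<le> 1" "\<And>\<phi>. \<phi> \<in> F U \<Longrightarrow> blinfun_apply \<phi> v = 0" "e / 2 < \<bar>\<psi> v\<bar>"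
      using ex_common_kernel_large[OF F(1)[OF U(1,2)], of "e/2" \<psi>] e(1) by (metis half_gt_zero less_imp_le)
    define p where "p = restrict (adjoint_op (rank_one f v)) dual_ball"
    have pE: "p \<in> enveloping_semigroup"
      using adjoint_maps_subset rank_one_contraction[OF f(1) v(1)] unfolding p_def by blast
    have "p \<phi> = 0" if "\<phi> \<in> F U" for \<phi>
    proof (rule blinfun_eqI)
      fix x
      have "\<phi> \<in> dual_ball" using F(3)[OF U(1,2)] that by blast
      then show "blinfun_apply (p \<phi>) x = blinfun_apply 0 x"
        using v(2)[OF that] by (simp add: p_def adjoint_rank_one_apply)
    qed
    then have "p \<in> U" using F(2)[OF U(1,2) pE] by blast
    then have "p \<in> O'" using U by blast
    then have "\<bar>f u * \<psi> v\<bar> < norm u * (e/2)"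
      using \<psi> by (auto simp: O'_def p_def adjoint_rank_one_apply)
    then have "norm u * \<bar>\<psi> v\<bar> < norm u * (e/2)" by (simp add: f(2) abs_mult)
    then show False using v(3) \<open>u \<noteq> 0\<close> by simp
  qed
  have dense: "\<psi> \<in> closure (span D)" for \<psi>
  proof -
    define c where "c = norm \<psi> + 1"
    have c: "0 < c" by (simp add: c_def add_nonneg_pos)
    then have "inverse c *\<^sub>R \<psi> \<in> closure (span D)"
      by (intro dense_ball) (auto simp: dual_ball_iff c_def field_simps)
    then have "c *\<^sub>R (inverse c *\<^sub>R \<psi>) \<in> (*\<^sub>R) c ` closure (span D)" by (rule imageI)
    also have "\<dots> = closure ((*\<^sub>R) c ` span D)" by (rule closure_scaleR)
    also have "\<dots> \<subseteq> closure (span D)" by (intro closure_mono) (auto intro: span_scale)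
    finally have "c *\<^sub>R (inverse c *\<^sub>R \<psi>) \<in> closure (span D)" .
    then show ?thesis using c by simp
  qed
  obtain C where C: "countable C" "span D \<subseteq> closure C"
    by (rule countable_dense_in_span[OF \<open>countable D\<close>])
  show thesis
  proof (rule that[OF C(1)])
    have "\<psi> \<in> closure C" for \<psi> using subsetD[OF closure_mono[OF C(2)] dense[of \<psi>]] by simp
    then show "closure C = UNIV" by blast
  qed
qed

lemma subspace_dual_dist_le:
  assumes W: "subspace W" and "f \<in> subspace_dual W" "g \<in> subspace_dual W"
    and le: "\<And>x. x \<in> W \<Longrightarrow> norm x \<le> 1 \<Longrightarrow> \<bar>f x - g x\<bar> \<le> e"
  shows "subspace_dual_dist W f g \<le> e"
proof -
  have "(SUP x\<in>{x \<in> W. norm x \<le> 1}. \<bar>f x - g x\<bar>) \<le> e"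
    using subspace_0[OF W] le by (intro cSUP_least) auto
  then show ?thesis using assms(2,3) by (simp add: subspace_dual_dist_def)
qed

lemma le_subspace_dual_dist:
  assumes "f \<in> subspace_dual W" "g \<in> subspace_dual W" "x \<in> W" "norm x \<le> 1"
  shows "\<bar>f x - g x\<bar> \<le> subspace_dual_dist W f g"
  using cSUP_upper[OF _ subspace_dual_dist_bound[OF assms(1,2)], of x] assms
  by (simp add: subspace_dual_dist_def)

lemma restrict_in_subspace_dual:
  fixes g :: "'a::real_normed_vector \<Rightarrow>\<^sub>L real"
  assumes "subspace W"
  shows "restrict (blinfun_apply g) W \<in> subspace_dual W"
proof -
  have "\<bar>g x\<bar> \<le> norm g * norm x" for x using norm_blinfun[of g x] by simp
  then show ?thesis using assms
    unfolding subspace_dual_def subspace_def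
    by (auto simp: blinfun.add_right blinfun.scaleR_right intro!: exI[of _ "norm g"])
qed

text \<open>A functional on \<open>W\<close> extends to the whole space, is approximated there, and restricting the
approximation to \<open>W\<close> does not increase the distance.\<close>

lemma asplund_if_dual_separable:
  fixes D :: "('a::banach \<Rightarrow>\<^sub>L real) set"
  assumes D: "countable D" "closure D = UNIV"
  shows "asplund TYPE('a)"
  unfolding asplund_def
proof (intro allI impI)
  fix W :: "'a set" assume "subspace W \<and> closed W \<and> separable_space (top_of_set W)"
  then have W: "subspace W" by blast
  interpret Metric_space "subspace_dual W" "subspace_dual_dist W"
    by (rule Metric_space_subspace_dual[OF W])
  define C where "C = (\<lambda>d. restrict (blinfun_apply d) W) ` D"
  have C: "C \<subseteq> subspace_dual W" using restrict_in_subspace_dual[OF W] by (auto simp: C_def)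
  have "\<exists>y\<in>C. y \<in> mball f r" if f: "f \<in> subspace_dual W" and r: "0 < r" for f r
  proof -
    obtain K where K: "\<And>x. x \<in> W \<Longrightarrow> \<bar>f x\<bar> \<le> K * norm x"
      using f unfolding subspace_dual_def by blast
    obtain g :: "'a \<Rightarrow>\<^sub>L real" where g: "\<And>x. x \<in> W \<Longrightarrow> g x = f x"
    proof (rule hahn_banach[OF W, of f "\<bar>K\<bar>"])
      show "\<bar>f x\<bar> \<le> \<bar>K\<bar> * norm x" if "x \<in> W" for x
        using K[OF that] mult_right_mono[OF abs_ge_self[of K] norm_ge_zero[of x]] by linarith
    qed (use f in \<open>auto simp: subspace_dual_def\<close>)
    obtain d where d: "d \<in> D" "dist d g < r / 2"
      using D(2) r closure_approachable[of g D] by (metis UNIV_I half_gt_zero)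
    define y where "y = restrict (blinfun_apply d) W"
    have y: "y \<in> C" using d by (simp add: C_def y_def)
    have "subspace_dual_dist W f y \<le> r / 2"
    proof (rule subspace_dual_dist_le[OF W f])
      show "y \<in> subspace_dual W" using y C by blast
      fix x assume x: "x \<in> W" "norm x \<le> 1"
      have "\<bar>f x - y x\<bar> = \<bar>blinfun_apply (g - d) x\<bar>" using g x by (simp add: y_def blinfun.diff_left)
      also have "\<dots> \<le> norm (g - d) * norm x" using norm_blinfun[of "g - d" x] by simp
      also have "\<dots> \<le> norm (g - d) * 1" using x by (intro mult_left_mono) auto
      finally show "\<bar>f x - y x\<bar> \<le> r / 2" using d by (simp add: dist_norm norm_minus_commute)
    qed
    then show ?thesis using y f r C by (intro bexI[of _ y]) auto
  qed
  then have "mtopology closure_of C = topspace mtopology" by (auto simp: metric_closure_of)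
  moreover have "countable C" using D(1) by (simp add: C_def)
  ultimately show "separable_space (subspace_dual_topology W)"
    unfolding separable_space_def subspace_dual_topology_def using C by auto
qed

lemma dual_separable_if_asplund:
  assumes sep: "separable_space (euclidean :: 'a::banach topology)" and asp: "asplund TYPE('a)"
  obtains D :: "('a::banach \<Rightarrow>\<^sub>L real) set" where "countable D" "closure D = UNIV"
proof -
  let ?U = "UNIV :: 'a set"
  interpret Metric_space "subspace_dual ?U" "subspace_dual_dist ?U"
    by (rule Metric_space_subspace_dual) simp
  have "separable_space mtopology"
    using asp sep unfolding asplund_def subspace_dual_topology_def[symmetric] by (auto dest: spec[of _ ?U])
  then obtain C where C: "countable C" "C \<subseteq> subspace_dual ?U" "mtopology closure_of C = subspace_dual ?U"
    by (auto simp: separable_space_def)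
  have app: "blinfun_apply (Blinfun f) = f" if f: "f \<in> subspace_dual ?U" for f
  proof -
    obtain K where "\<And>x. \<bar>f x\<bar> \<le> K * norm x" using f unfolding subspace_dual_def by blast
    then have "bounded_linear f"
      using f by (intro bounded_linear_intro[of _ K]) (auto simp: subspace_dual_def mult.commute)
    then show ?thesis by (rule bounded_linear_Blinfun_apply)
  qed
  show thesis
  proof (rule that[of "Blinfun ` C"])
    show "countable (Blinfun ` C)" using C(1) by simp
    have "g \<in> closure (Blinfun ` C)" for g :: "'a \<Rightarrow>\<^sub>L real"
      unfolding closure_approachable
    proof (intro allI impI)
      fix e :: real assume e: "0 < e"
      have g: "blinfun_apply g \<in> subspace_dual ?U"
        using restrict_in_subspace_dual[of ?U g] by (simp add: restrict_def)
      then have "blinfun_apply g \<in> mtopology closure_of C" by (simp add: C(3))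
      then have "\<exists>f\<in>C. f \<in> mball (blinfun_apply g) (e/2)"
        unfolding metric_closure_of using half_gt_zero[OF e] by blast
      then obtain f where f: "f \<in> C" "f \<in> subspace_dual ?U" "subspace_dual_dist ?U (blinfun_apply g) f < e / 2"
        by auto
      have small: "\<bar>blinfun_apply (g - Blinfun f) x\<bar> \<le> e / 2" if "norm x \<le> 1" for x
        using le_subspace_dual_dist[OF g f(2), of x] that f(3) by (simp add: blinfun.diff_left app[OF f(2)])
      have "norm (g - Blinfun f) \<le> e / 2"
      proof (rule norm_blinfun_bound)
        fix x
        show "norm (blinfun_apply (g - Blinfun f) x) \<le> e / 2 * norm x"
        proof (cases "x = 0")
          case False
          then have "\<bar>blinfun_apply (g - Blinfun f) (inverse (norm x) *\<^sub>R x)\<bar> \<le> e / 2"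
            by (intro small) simp
          then show ?thesis using False by (simp add: blinfun.scaleR_right abs_mult field_simps)
        qed simp
      qed (use e in simp)
      then show "\<exists>y\<in>Blinfun ` C. dist y g < e"
        using f(1) e by (intro bexI[of _ "Blinfun f"]) (auto simp: dist_norm norm_minus_commute)
    qed
    then show "closure (Blinfun ` C) = UNIV" by blast
  qed
qed

section \<open>The enveloping semigroup in coordinates\<close>

text \<open>Agreement of \<open>p\<close> and \<open>q\<close> extends from a dense set of functionals to the dual ball because both are
nonexpansive, and from a dense set of vectors because their values are continuous functionals.\<close>

lemma enveloping_coordinates:
  fixes D :: "('a::real_normed_vector \<Rightarrow>\<^sub>L real) set"
  assumes D: "countable D" "closure D = UNIV" and sep: "separable_space (euclidean :: 'a topology)"
  obtains a :: "nat \<Rightarrow> ('a \<Rightarrow>\<^sub>L real)" and b :: "nat \<Rightarrow> 'a"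
  where "\<And>n. a n \<in> dual_ball"
    and "inj_on (\<lambda>p n. blinfun_apply (p (a n)) (b n)) enveloping_semigroup"
proof -
  obtain C :: "'a set" where C: "countable C" "closure C = UNIV"
    using sep by (auto simp: separable_space_def)
  define D' where "D' = ball 0 1 \<inter> D"
  have D': "countable D'" "dual_ball \<subseteq> closure D'"
  proof -
    show "countable D'" using D(1) by (auto simp: D'_def)
    have "ball 0 1 \<subseteq> closure D'"
      using open_Int_closure_subset[of "ball 0 1" D] D(2) by (simp add: D'_def)
    then have "closure (ball 0 1) \<subseteq> closure (closure D')" by (rule closure_mono)
    then show "dual_ball \<subseteq> closure D'" by (simp add: dual_ball_def)
  qed
  have ne: "C \<noteq> {}" "D' \<noteq> {}"
  proof -
    show "C \<noteq> {}" using C(2) by auto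
    have "(0 :: 'a \<Rightarrow>\<^sub>L real) \<in> closure D'" using D'(2) by (auto simp: dual_ball_iff)
    then show "D' \<noteq> {}" by auto
  qed
  define a where "a n = from_nat_into D' (fst (prod_decode n))" for n
  define b where "b n = from_nat_into C (snd (prod_decode n))" for n
  have cover: "\<exists>n. a n = \<phi> \<and> b n = v" if "\<phi> \<in> D'" "v \<in> C" for \<phi> v
    using that from_nat_into_to_nat_on[OF D'(1)] from_nat_into_to_nat_on[OF C(1)]
    by (intro exI[of _ "prod_encode (to_nat_on D' \<phi>, to_nat_on C v)"]) (simp add: a_def b_def)
  show thesis
  proof (rule that[of a b])
    show "a n \<in> dual_ball" for n
      using from_nat_into[OF ne(2), of "fst (prod_decode n)"] by (simp add: a_def D'_def dual_ball_iff)
    show "inj_on (\<lambda>p n. blinfun_apply (p (a n)) (b n)) enveloping_semigroup"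
    proof (rule inj_onI)
      fix p q :: "('a \<Rightarrow>\<^sub>L real) \<Rightarrow> ('a \<Rightarrow>\<^sub>L real)"
      assume p: "p \<in> enveloping_semigroup" and q: "q \<in> enveloping_semigroup"
        and eq: "(\<lambda>n. blinfun_apply (p (a n)) (b n)) = (\<lambda>n. blinfun_apply (q (a n)) (b n))"
      have eq0: "blinfun_apply (p \<phi>) v = blinfun_apply (q \<phi>) v" if "\<phi> \<in> D'" "v \<in> C" for \<phi> v
        using cover[OF that] fun_cong[OF eq] by metis
      have eq1: "blinfun_apply (p \<phi>) v = blinfun_apply (q \<phi>) v" if \<phi>: "\<phi> \<in> dual_ball" and v: "v \<in> C" for \<phi> v
      proof -
        obtain \<xi> where \<xi>: "\<forall>n. \<xi> n \<in> D'" "\<xi> \<longlonglongrightarrow> \<phi>"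
          using subsetD[OF D'(2) \<phi>] unfolding closure_sequential by (elim exE conjE)
        have "\<bar>blinfun_apply (p \<phi>) v - blinfun_apply (q \<phi>) v\<bar> \<le> 2 * norm (\<xi> n - \<phi>) * norm v" for n
        proof -
          have "\<xi> n \<in> D'" using \<xi>(1) by blast
          then have \<xi>n: "\<xi> n \<in> dual_ball" by (simp add: D'_def dual_ball_iff)
          show ?thesis
            using enveloping_nonexpansive[OF p \<phi> \<xi>n, of v] enveloping_nonexpansive[OF q \<phi> \<xi>n, of v]
              eq0[OF \<open>\<xi> n \<in> D'\<close> v] by (simp add: norm_minus_commute)
        qed
        moreover have "(\<lambda>n. 2 * norm (\<xi> n - \<phi>) * norm v) \<longlonglongrightarrow> 2 * norm (\<phi> - \<phi>) * norm v"
          by (intro tendsto_intros \<xi>(2))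
        ultimately have "\<bar>blinfun_apply (p \<phi>) v - blinfun_apply (q \<phi>) v\<bar> \<le> 2 * norm (\<phi> - \<phi>) * norm v"
          by (intro LIMSEQ_le_const) auto
        then show ?thesis by simp
      qed
      have "p \<phi> = q \<phi>" if \<phi>: "\<phi> \<in> dual_ball" for \<phi>
      proof (rule blinfun_eqI)
        fix x
        have "closed {x. blinfun_apply (p \<phi>) x = blinfun_apply (q \<phi>) x}"
          by (intro closed_Collect_eq continuous_intros)
        then have "closure C \<subseteq> {x. blinfun_apply (p \<phi>) x = blinfun_apply (q \<phi>) x}"
          using eq1[OF \<phi>] by (intro closure_minimal) auto
        then show "blinfun_apply (p \<phi>) x = blinfun_apply (q \<phi>) x" using C(2) by blast
      qed
      then show "p = q" by (rule PiE_ext[OF enveloping_PiE[OF p] enveloping_PiE[OF q]])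
    qed
  qed
qed

lemma ex_nonzero_common_kernel:
  fixes F :: "('a::real_normed_vector \<Rightarrow>\<^sub>L real) set"
  assumes "infinite_dimensional TYPE('a)" "finite F"
  obtains v :: 'a where "v \<noteq> 0" "\<And>\<phi>. \<phi> \<in> F \<Longrightarrow> blinfun_apply \<phi> v = 0"
proof -
  obtain B where B: "finite B" "\<And>u. \<exists>x\<in>span B. \<forall>\<phi>\<in>F. blinfun_apply \<phi> (u - x) = 0"
    using finite_codimension_common_kernel[OF assms(2)] by blast
  then obtain u where "u \<notin> span B" using assms(1) unfolding infinite_dimensional_def by blast
  obtain x where "x \<in> span B" "\<forall>\<phi>\<in>F. blinfun_apply \<phi> (u - x) = 0" using B(2) by blast
  then show thesis using that[of "u - x"] \<open>u \<notin> span B\<close> by fastforce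
qed

text \<open>The description as a closure makes convexity and symmetry of the image evident from the
linearity in \<open>T\<close>.\<close>

lemma enveloping_homeomorphic_image:
  fixes a :: "nat \<Rightarrow> ('a::real_normed_vector \<Rightarrow>\<^sub>L real)" and b :: "nat \<Rightarrow> 'a"
  assumes a: "\<And>n. a n \<in> dual_ball"
    and inj: "inj_on (\<lambda>p n. blinfun_apply (p (a n)) (b n)) enveloping_semigroup"
  defines "L \<equiv> (\<lambda>p n. blinfun_apply (p (a n)) (b n)) ` enveloping_semigroup"
  shows "compact L"
    and "enveloping_topology TYPE('a) homeomorphic_space top_of_set L"
    and "L = closure ((\<lambda>T n. blinfun_apply (a n) (blinfun_apply T (b n))) ` contractions)"
proof -
  define \<Phi> where "\<Phi> p n = blinfun_apply (p (a n)) (b n)" for p :: "('a \<Rightarrow>\<^sub>L real) \<Rightarrow> ('a \<Rightarrow>\<^sub>L real)" and n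
  have L: "L = \<Phi> ` enveloping_semigroup" by (simp add: L_def \<Phi>_def[abs_def])
  have cont_maps: "continuous_map dual_ball_maps_topology euclidean \<Phi>"
    unfolding euclidean_product_topology[symmetric] continuous_map_componentwise_UNIV \<Phi>_def
    by (intro allI continuous_map_maps_eval a)
  then have cont: "continuous_map (enveloping_topology TYPE('a)) euclidean \<Phi>"
    unfolding enveloping_topology_def by (rule continuous_map_from_subtopology)
  show compact: "compact L"
    using image_compactin[OF _ cont] compact_enveloping[where 'a='a]
    by (simp add: L compact_space_def topspace_enveloping_topology)
  have "homeomorphic_map (enveloping_topology TYPE('a)) (top_of_set L) \<Phi>"
  proof (rule continuous_imp_homeomorphic_map)
    show "continuous_map (enveloping_topology TYPE('a)) (top_of_set L) \<Phi>"
      using cont by (auto simp: continuous_map_in_subtopology L topspace_enveloping_topology)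
    show "Hausdorff_space (top_of_set L)" by (intro Hausdorff_space_subtopology) simp
    show "inj_on \<Phi> (topspace (enveloping_topology TYPE('a)))"
      using inj by (simp add: topspace_enveloping_topology \<Phi>_def[abs_def])
  qed (simp_all add: compact_enveloping topspace_enveloping_topology L)
  then show "enveloping_topology TYPE('a) homeomorphic_space top_of_set L"
    by (rule homeomorphic_map_imp_homeomorphic_space)
  have adj: "\<Phi> ` adjoint_maps = (\<lambda>T n. blinfun_apply (a n) (blinfun_apply T (b n))) ` contractions"
    using a by (auto simp: image_image \<Phi>_def adjoint_op_def intro!: image_cong)
  show "L = closure ((\<lambda>T n. blinfun_apply (a n) (blinfun_apply T (b n))) ` contractions)"
    unfolding adj[symmetric]
  proof
    show "L \<subseteq> closure (\<Phi> ` adjoint_maps)"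
      using continuous_map_image_closure_subset[OF cont_maps, of adjoint_maps]
      by (simp add: L enveloping_semigroup_def)
    show "closure (\<Phi> ` adjoint_maps) \<subseteq> L"
      using adjoint_maps_subset compact by (intro closure_minimal compact_imp_closed) (auto simp: L)
  qed
qed

lemma closure_linear_combination:
  fixes S :: "(nat \<Rightarrow> real) set"
  assumes S: "\<And>x y. x \<in> S \<Longrightarrow> y \<in> S \<Longrightarrow> (\<lambda>i. c * x i + d * y i) \<in> S"
    and x: "x \<in> closure S" and y: "y \<in> closure S"
  shows "(\<lambda>i. c * x i + d * y i) \<in> closure S"
proof -
  obtain f where f: "\<forall>n. f n \<in> S" "f \<longlonglongrightarrow> x" using x unfolding closure_sequential by (elim exE conjE)
  obtain g where g: "\<forall>n. g n \<in> S" "g \<longlonglongrightarrow> y" using y unfolding closure_sequential by (elim exE conjE)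
  have coord: "(\<lambda>n. h n i) \<longlonglongrightarrow> z i" if "h \<longlonglongrightarrow> z" for h :: "nat \<Rightarrow> nat \<Rightarrow> real" and z i
    using continuous_on_tendsto_compose[OF continuous_on_product_coordinates[of i] that] by simp
  have "(\<lambda>n i. c * f n i + d * g n i) \<longlonglongrightarrow> (\<lambda>i. c * x i + d * y i)"
    by (rule tendsto_coordinatewise, rule tendsto_add; rule tendsto_mult_left)
      (fact coord[OF f(2)] coord[OF g(2)])+
  then show ?thesis
    unfolding closure_sequential using S f(1) g(1) by (intro exI[of _ "\<lambda>n i. c * f n i + d * g n i"]) auto
qed

lemma combine_contractions:
  assumes "T \<in> contractions" "S \<in> contractions" "\<bar>c\<bar> + \<bar>d\<bar> \<le> 1"
  shows "c *\<^sub>R T + d *\<^sub>R S \<in> contractions"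
proof -
  have "norm (c *\<^sub>R T + d *\<^sub>R S) \<le> \<bar>c\<bar> * norm T + \<bar>d\<bar> * norm S"
    by (metis norm_triangle_ineq norm_scaleR)
  also have "\<dots> \<le> \<bar>c\<bar> * 1 + \<bar>d\<bar> * 1"
    using assms by (intro add_mono mult_left_mono) (auto simp: contractions_def)
  finally show ?thesis using assms(3) by (simp add: contractions_def)
qed

text \<open>A rank one operator whose range is spanned by a common zero \<open>w\<close> of \<open>a\<^sub>0, \<dots>, a\<^sub>n\<^sub>-\<^sub>1\<close> has an adjoint that
vanishes at these functionals, which gives nonzero points with vanishing first coordinates.\<close>

lemma enveloping_homeomorphic_hilbert_cube:
  fixes D :: "('a::real_normed_vector \<Rightarrow>\<^sub>L real) set"
  assumes D: "countable D" "closure D = UNIV" and sep: "separable_space (euclidean :: 'a topology)"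
    and inf: "infinite_dimensional TYPE('a)"
  shows "enveloping_topology TYPE('a) homeomorphic_space hilbert_cube"
proof -
  obtain a :: "nat \<Rightarrow> ('a \<Rightarrow>\<^sub>L real)" and b :: "nat \<Rightarrow> 'a" where a: "\<And>n. a n \<in> dual_ball"
    and inj: "inj_on (\<lambda>p n. blinfun_apply (p (a n)) (b n)) enveloping_semigroup"
    by (rule enveloping_coordinates[OF D sep]) blast
  define L where "L = (\<lambda>p n. blinfun_apply (p (a n)) (b n)) ` enveloping_semigroup"
  define \<Psi> where "\<Psi> T n = blinfun_apply (a n) (blinfun_apply T (b n))" for T :: "'a \<Rightarrow>\<^sub>L 'a" and n
  note E = enveloping_homeomorphic_image[of a b, OF a inj, folded L_def \<Psi>_def[abs_def]]
  have comb: "(\<lambda>i. c * x i + d * y i) \<in> L" if "x \<in> L" "y \<in> L" "\<bar>c\<bar> + \<bar>d\<bar> \<le> 1" for c d x y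
    unfolding E(3)
  proof (rule closure_linear_combination)
    show "(\<lambda>i. c * x i + d * y i) \<in> \<Psi> ` contractions"
      if xy: "x \<in> \<Psi> ` contractions" "y \<in> \<Psi> ` contractions" for x y
    proof -
      obtain T S where TS: "T \<in> contractions" "x = \<Psi> T" "S \<in> contractions" "y = \<Psi> S"
        using xy by blast
      have "(\<lambda>i. c * x i + d * y i) = \<Psi> (c *\<^sub>R T + d *\<^sub>R S)"
        by (rule ext) (simp add: TS \<Psi>_def blinfun.add_left blinfun.add_right blinfun.scaleR_left blinfun.scaleR_right)
      then show ?thesis using combine_contractions[OF TS(1,3) \<open>\<bar>c\<bar> + \<bar>d\<bar> \<le> 1\<close>] by blast
    qed
  qed (use that E(3) in auto)
  have "top_of_set L homeomorphic_space hilbert_cube"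
  proof (rule keller_symmetric[OF E(1)])
    show "(\<lambda>i. u * x i + (1 - u) * y i) \<in> L" if "x \<in> L" "y \<in> L" "0 \<le> u" "u \<le> 1" for x y u
      using that by (intro comb) auto
    show "(\<lambda>i. - x i) \<in> L" if "x \<in> L" for x
      using comb[OF that that, of "-1" 0] by simp
    fix n
    obtain w :: 'a where w: "w \<noteq> 0" "\<And>\<phi>. \<phi> \<in> a ` {..<n} \<Longrightarrow> blinfun_apply \<phi> w = 0"
      by (rule ex_nonzero_common_kernel[OF inf, of "a ` {..<n}"]) auto
    obtain f :: "'a \<Rightarrow>\<^sub>L real" where f: "norm f \<le> 1" "f w = norm w" by (rule ex_dual_norming)
    define v where "v = inverse (norm w) *\<^sub>R w"
    define T where "T = rank_one f v"
    have T: "T \<in> contractions" unfolding T_def using f(1) w(1) by (intro rank_one_contraction) (auto simp: v_def)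
    have 0: "0 \<in> contractions" by (simp add: contractions_def)
    have f_ball: "f \<in> dual_ball" using f by (simp add: dual_ball_iff)
    define \<Phi> where "\<Phi> p n = blinfun_apply (p (a n)) (b n)" for p :: "('a \<Rightarrow>\<^sub>L real) \<Rightarrow> ('a \<Rightarrow>\<^sub>L real)" and n
    have \<Phi>: "\<Psi> S = \<Phi> (restrict (adjoint_op S) dual_ball)" for S
      by (rule ext) (use a in \<open>simp add: \<Psi>_def \<Phi>_def adjoint_op_def\<close>)
    have "\<Psi> T \<noteq> \<Psi> 0"
    proof
      assume "\<Psi> T = \<Psi> 0"
      then have "restrict (adjoint_op T) dual_ball = restrict (adjoint_op 0) dual_ball"
        using inj adjoint_maps_subset T 0 unfolding \<Phi> inj_on_def \<Phi>_def[abs_def] by blast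
      from fun_cong[OF this, of f] have "blinfun_apply (adjoint_op T f) w = 0"
        using f_ball by (simp add: adjoint_op_def)
      moreover have "blinfun_apply f v = 1" using f(2) w(1) by (simp add: v_def blinfun.scaleR_right)
      ultimately show False using f(2) w(1) by (simp add: T_def adjoint_rank_one_apply)
    qed
    moreover have "\<Psi> 0 = (\<lambda>_. 0)" by (rule ext) (simp add: \<Psi>_def)
    moreover have "\<Psi> T i = 0" if "i < n" for i
      using w(2)[of "a i"] that by (simp add: \<Psi>_def T_def rank_one_apply v_def blinfun.scaleR_right)
    moreover have "\<Psi> T \<in> L" 
      unfolding E(3) by (rule subsetD[OF closure_subset imageI[OF T]])
    ultimately show "\<exists>x\<in>L. x \<noteq> (\<lambda>_. 0) \<and> (\<forall>i<n. x i = 0)"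
      by (intro bexI[of _ "\<Psi> T"]) auto
  qed
  with E(2) show ?thesis by (rule homeomorphic_space_trans)
qed

lemma metrizable_enveloping:
  fixes D :: "('a::real_normed_vector \<Rightarrow>\<^sub>L real) set"
  assumes D: "countable D" "closure D = UNIV" and sep: "separable_space (euclidean :: 'a topology)"
  shows "metrizable_space (enveloping_topology TYPE('a))"
proof -
  obtain a :: "nat \<Rightarrow> ('a \<Rightarrow>\<^sub>L real)" and b :: "nat \<Rightarrow> 'a" where ab: "\<And>n. a n \<in> dual_ball"
    "inj_on (\<lambda>p n. blinfun_apply (p (a n)) (b n)) enveloping_semigroup"
    by (rule enveloping_coordinates[OF D sep]) blast
  from homeomorphic_metrizable_space[OF enveloping_homeomorphic_image(2)[of a b, OF ab]]
  show ?thesis by (simp add: metrizable_space_subtopology metrizable_space_euclidean)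
qed

lemma metrizable_hilbert_cube: "metrizable_space hilbert_cube"
  unfolding hilbert_cube_def metrizable_space_product_topology
  by (simp add: metrizable_space_subtopology metrizable_space_euclidean)

theorem theorem6p11:
  shows "(separable_space (euclidean :: 'a::banach topology) \<and> asplund TYPE('a)
            \<longleftrightarrow> metrizable_space (enveloping_topology TYPE('a)))
       \<and> (infinite_dimensional TYPE('a) \<longrightarrow>
            (separable_space (euclidean :: 'a topology) \<and> asplund TYPE('a)
              \<longleftrightarrow> enveloping_topology TYPE('a) homeomorphic_space hilbert_cube))"
proof -
  have 31: "separable_space (euclidean :: 'a topology) \<and> asplund TYPE('a)"
    if met: "metrizable_space (enveloping_topology TYPE('a))"
  proof -
    obtain D :: "('a \<Rightarrow>\<^sub>L real) set" where "countable D" "closure D = UNIV"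
      by (rule dual_separable_if_first_countable[OF metrizable_imp_first_countable[OF met]])
    then show ?thesis using separable_if_separable_dual asplund_if_dual_separable by blast
  qed
  have 13: "metrizable_space (enveloping_topology TYPE('a))"
    if sep: "separable_space (euclidean :: 'a topology)" and asp: "asplund TYPE('a)"
  proof -
    obtain D :: "('a \<Rightarrow>\<^sub>L real) set" where "countable D" "closure D = UNIV"
      by (rule dual_separable_if_asplund[OF sep asp])
    then show ?thesis using sep by (rule metrizable_enveloping)
  qed
  have 12: "enveloping_topology TYPE('a) homeomorphic_space hilbert_cube"
    if sep: "separable_space (euclidean :: 'a topology)" and asp: "asplund TYPE('a)"
      and inf: "infinite_dimensional TYPE('a)"
  proof -
    obtain D :: "('a \<Rightarrow>\<^sub>L real) set" where "countable D" "closure D = UNIV"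
      by (rule dual_separable_if_asplund[OF sep asp])
    then show ?thesis using sep inf by (rule enveloping_homeomorphic_hilbert_cube)
  qed
  have 23: "metrizable_space (enveloping_topology TYPE('a))"
    if "enveloping_topology TYPE('a) homeomorphic_space hilbert_cube"
    using homeomorphic_metrizable_space[OF that] metrizable_hilbert_cube by blast
  show ?thesis using 31 13 12 23 by blast
qed

end
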